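(* Let $1\le t\le n$, let $\Gamma_{n,t}$ be the $t$-path simplicial tree of the path graph $P_n$, let $I_{n,t}=I(\Gamma_{n,t})$, and let $1\le k\le\nu(\Gamma_{n,t})$. Then $\beta_{1,p}\bigl(I_{n,t}^{[k]}\bigr)=0$ whenever $p\notin\{kt+1,(k+1)t\}$.
   Context: $P_n$ is the path graph on vertices $1,\ldots,n$ with edges $\{i,i+1\}$, $1\le i\le n-1$. $\Gamma_{n,t}$ is the simplicial complex with facets $F_i=\{i,i+1,\ldots,i+t-1\}$ for $i=1,\ldots,n-t+1$. The $t$-path ideal $I_{n,t}=I(\Gamma_{n,t})\subset R=K[x_1,\dots,x_n]$ ($K$ a field) is generated by the monomials $\prod_{j\in F_i}x_j$, $1\le i\le n-t+1$. For a squarefree monomial ideal $I$, $I^{[k]}$ is the ideal generated by the squarefree monomials among the minimal monomial generators of $I^k$. A matching is a set of pairwise disjoint facets, and $\nu(\Gamma_{n,t})$ is the maximum size of a matching of $\Gamma_{n,t}$; $I_{n,t}^{[k]}\neq0$ iff $1\le k\le\nu(\Gamma_{n,t})$. $\beta_{i,p}(I)$ denotes the graded Betti numbers of the minimal graded free resolution of $I$ (not of $R/I$) as an $R$-module, so $\beta_{0,p}(I)$ counts the minimal generators of degree $p$. *)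

theory Defs
  imports Complex_Main "HOL-Library.Poly_Mapping"
begin

section \<open>Polynomials in \<open>x\<^sub>1, \<dots>, x\<^sub>n\<close> and monomial ideals\<close>

text \<open>
  A monomial is its exponent vector \<open>nat \<Rightarrow>\<^sub>0 nat\<close>. The type \<open>'a mpoly\<close> has variables
  \<open>x\<^sub>i\<close> for all \<open>i :: nat\<close>; the ring \<open>R = K[x\<^sub>1, \<dots>, x\<^sub>n]\<close> is the carrier set \<open>mpolys n\<close>.
\<close>

type_synonym monomial = "nat \<Rightarrow>\<^sub>0 nat"
type_synonym 'a mpoly = "monomial \<Rightarrow>\<^sub>0 'a"

definition mpolys :: "nat \<Rightarrow> 'a::field mpoly set" where
  "mpolys n = {f. \<forall>m \<in> Poly_Mapping.keys f. Poly_Mapping.keys m \<subseteq> {1..n}}"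

definition var :: "nat \<Rightarrow> 'a::field mpoly" where
  "var i = Poly_Mapping.single (Poly_Mapping.single i 1) 1"

definition monom :: "monomial \<Rightarrow> 'a::field mpoly" where
  "monom m = Poly_Mapping.single m 1"

definition mdegree :: "monomial \<Rightarrow> nat" where
  "mdegree m = (\<Sum>i \<in> Poly_Mapping.keys m. Poly_Mapping.lookup m i)"

definition mdivides :: "monomial \<Rightarrow> monomial \<Rightarrow> bool" where
  "mdivides m m' \<longleftrightarrow> (\<forall>i. Poly_Mapping.lookup m i \<le> Poly_Mapping.lookup m' i)"

definition squarefree_monomial :: "monomial \<Rightarrow> bool" where
  "squarefree_monomial m \<longleftrightarrow> (\<forall>i. Poly_Mapping.lookup m i \<le> 1)"

definition ideal_gen :: "nat \<Rightarrow> 'a::field mpoly set \<Rightarrow> 'a mpoly set" where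
  "ideal_gen n S = {(\<Sum>g \<in> T. c g * g) | T c. finite T \<and> T \<subseteq> S \<and> (\<forall>g \<in> T. c g \<in> mpolys n)}"

fun ideal_power :: "nat \<Rightarrow> 'a::field mpoly set \<Rightarrow> nat \<Rightarrow> 'a mpoly set" where
  "ideal_power n I 0 = mpolys n"
| "ideal_power n I (Suc k) = ideal_gen n {f * g | f g. f \<in> I \<and> g \<in> ideal_power n I k}"

text \<open>The minimal monomial generators of a monomial ideal are the monomials it contains
  that are minimal with respect to divisibility.\<close>

definition min_monomial_gens :: "'a::field mpoly set \<Rightarrow> monomial set" where
  "min_monomial_gens J =
     {m. monom m \<in> J \<and> (\<forall>m'. monom m' \<in> J \<and> mdivides m' m \<longrightarrow> m' = m)}"

text \<open>The squarefree power \<open>I\<^bsup>[k]\<^esup>\<close>.\<close>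

definition squarefree_power :: "nat \<Rightarrow> 'a::field mpoly set \<Rightarrow> nat \<Rightarrow> 'a mpoly set" where
  "squarefree_power n I k =
     ideal_gen n (monom ` {m \<in> min_monomial_gens (ideal_power n I k). squarefree_monomial m})"


section \<open>Simplicial complexes, facet ideals and matchings\<close>

text \<open>A simplicial complex is given by its set of faces.\<close>

definition facets :: "nat set set \<Rightarrow> nat set set" where
  "facets \<Delta> = {F \<in> \<Delta>. \<forall>G \<in> \<Delta>. F \<subseteq> G \<longrightarrow> G = F}"

definition facet_ideal :: "nat \<Rightarrow> nat set set \<Rightarrow> 'a::field mpoly set" where
  "facet_ideal n \<Delta> = ideal_gen n {(\<Prod>j \<in> F. var j) | F. F \<in> facets \<Delta>}"

definition is_matching :: "nat set set \<Rightarrow> nat set set \<Rightarrow> bool" where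
  "is_matching \<Delta> M \<longleftrightarrow> M \<subseteq> facets \<Delta> \<and> pairwise disjnt M"

definition matching_number :: "nat set set \<Rightarrow> nat" where
  "matching_number \<Delta> = Max {card M | M. is_matching \<Delta> M}"

text \<open>The \<open>t\<close>-path complex \<open>\<Gamma>\<^bsub>n,t\<^esub>\<close> of the path graph on \<open>1, \<dots>, n\<close>, for \<open>1 \<le> t \<le> n\<close>.\<close>

definition path_complex :: "nat \<Rightarrow> nat \<Rightarrow> nat set set" where
  "path_complex n t = {A. \<exists>i \<in> {1..n - t + 1}. A \<subseteq> {i..i + t - 1}}"

lemma facets_path_complex:
  assumes "1 \<le> t" "t \<le> n"
  shows "facets (path_complex n t) = {{i..i + t - 1} | i. i \<in> {1..n - t + 1}}"
proof -
  have eq: "i = j" if "{i..i + t - 1} \<subseteq> {j..j + t - 1}" for i j :: nat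
    using that assms(1) by auto
  show ?thesis
  proof (intro set_eqI iffI)
    fix F assume F: "F \<in> facets (path_complex n t)"
    then obtain i where i: "i \<in> {1..n - t + 1}" "F \<subseteq> {i..i + t - 1}"
      by (auto simp: facets_def path_complex_def)
    have "{i..i + t - 1} \<in> path_complex n t"
      using i(1) by (auto simp: path_complex_def)
    with F i(2) have "F = {i..i + t - 1}"
      by (auto simp: facets_def)
    with i(1) show "F \<in> {{i..i + t - 1} | i. i \<in> {1..n - t + 1}}" by blast
  next
    fix F assume "F \<in> {{i..i + t - 1} | i. i \<in> {1..n - t + 1}}"
    then obtain i where i: "i \<in> {1..n - t + 1}" "F = {i..i + t - 1}" by blast
    have "G = F" if "G \<in> path_complex n t" "F \<subseteq> G" for G
    proof -
      from that(1) obtain j where j: "G \<subseteq> {j..j + t - 1}"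
        by (auto simp: path_complex_def)
      with that(2) i(2) eq[of i j] have "i = j" by blast
      with j that(2) i(2) show ?thesis by blast
    qed
    moreover have "F \<in> path_complex n t"
      unfolding path_complex_def using i by blast
    ultimately show "F \<in> facets (path_complex n t)"
      by (auto simp: facets_def)
  qed
qed


section \<open>Minimal graded free resolutions and graded Betti numbers\<close>

text \<open>
  The graded free module \<open>\<Oplus>\<^sub>p R(-p)\<^bsup>b p\<^esup>\<close> has the basis elements \<open>(p, j)\<close> with
  \<open>j < b p\<close>, where \<open>(p, j)\<close> has degree \<open>p\<close>. Its elements are the finitely supported
  functions from basis elements to \<open>R\<close>.
\<close>

type_synonym 'a fvec = "nat \<times> nat \<Rightarrow>\<^sub>0 'a mpoly"

definition basis :: "(nat \<Rightarrow> nat) \<Rightarrow> (nat \<times> nat) set" where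
  "basis b = {(p, j). j < b p}"

definition free_module :: "nat \<Rightarrow> (nat \<Rightarrow> nat) \<Rightarrow> 'a::field fvec set" where
  "free_module n b =
     {v. Poly_Mapping.keys v \<subseteq> basis b \<and>
     (\<forall>x \<in> Poly_Mapping.keys v. Poly_Mapping.lookup v x \<in> mpolys n)}"

definition homogeneous :: "nat \<Rightarrow> 'a::field mpoly \<Rightarrow> bool" where
  "homogeneous d f \<longleftrightarrow> (\<forall>m \<in> Poly_Mapping.keys f. mdegree m = d)"

definition fvec_homogeneous :: "nat \<Rightarrow> 'a::field fvec \<Rightarrow> bool" where
  "fvec_homogeneous d v \<longleftrightarrow>
     (\<forall>x \<in> Poly_Mapping.keys v. \<forall>m \<in> Poly_Mapping.keys (Poly_Mapping.lookup v x). fst x + mdegree m = d)"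

definition fvec_scale :: "'a::field mpoly \<Rightarrow> 'a fvec \<Rightarrow> 'a fvec" where
  "fvec_scale r v = Poly_Mapping.map ((*) r) v"

text \<open>\<open>R\<close>-linear maps out of a free module are given by the images of the basis elements.
  The two versions below have values in \<open>R\<close> and in a free module, respectively.\<close>

definition lin_poly :: "(nat \<times> nat \<Rightarrow> 'a::field mpoly) \<Rightarrow> 'a fvec \<Rightarrow> 'a mpoly" where
  "lin_poly e v = (\<Sum>x \<in> Poly_Mapping.keys v. Poly_Mapping.lookup v x * e x)"

definition lin_fvec :: "(nat \<times> nat \<Rightarrow> 'a::field fvec) \<Rightarrow> 'a fvec \<Rightarrow> 'a fvec" where
  "lin_fvec d v = (\<Sum>x \<in> Poly_Mapping.keys v. fvec_scale (Poly_Mapping.lookup v x) (d x))"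

text \<open>
  A minimal graded free resolution
  \<open>\<dots> \<rightarrow> F\<^sub>2 \<rightarrow> F\<^sub>1 \<rightarrow> F\<^sub>0 \<rightarrow> I \<rightarrow> 0\<close> of a homogeneous ideal \<open>I\<close> of \<open>R\<close>, with
  \<open>F\<^sub>i = \<Oplus>\<^sub>p R(-p)\<^bsup>b i p\<^esup>\<close>, augmentation \<open>e : F\<^sub>0 \<rightarrow> I\<close> and differentials
  \<open>d i : F\<^bsub>i+1\<^esub> \<rightarrow> F\<^sub>i\<close>, all homogeneous of degree 0. Minimality says that the image of
  each differential lies in \<open>(x\<^sub>1, \<dots>, x\<^sub>n) F\<^sub>i\<close>, i.e. the matrix entries have no constant
  term. Each \<open>F\<^sub>i\<close> is only required to have finite rank in every degree; that
  it has finite rank altogether is then automatic from minimality, since \<open>R\<close> is Noetherian.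
\<close>

definition minimal_graded_free_resolution ::
  "nat \<Rightarrow> 'a::field mpoly set \<Rightarrow> (nat \<Rightarrow> nat \<Rightarrow> nat) \<Rightarrow> (nat \<times> nat \<Rightarrow> 'a mpoly)
     \<Rightarrow> (nat \<Rightarrow> nat \<times> nat \<Rightarrow> 'a fvec) \<Rightarrow> bool" where
  "minimal_graded_free_resolution n I b e d \<longleftrightarrow>
     (\<forall>x \<in> basis (b 0). e x \<in> mpolys n \<and> homogeneous (fst x) (e x)) \<and>
     (\<forall>i. \<forall>x \<in> basis (b (Suc i)).
        d i x \<in> free_module n (b i) \<and> fvec_homogeneous (fst x) (d i x)) \<and>
     lin_poly e ` free_module n (b 0) = I \<and>
     lin_fvec (d 0) ` free_module n (b 1) = {v \<in> free_module n (b 0). lin_poly e v = 0} \<and>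
     (\<forall>i. lin_fvec (d (Suc i)) ` free_module n (b (Suc (Suc i))) =
        {v \<in> free_module n (b (Suc i)). lin_fvec (d i) v = 0}) \<and>
     (\<forall>i. \<forall>x \<in> basis (b (Suc i)). \<forall>y. Poly_Mapping.lookup (Poly_Mapping.lookup (d i x) y) 0 = 0)"

text \<open>Minimal graded free resolutions are unique up to isomorphism, so that their graded
  ranks depend only on \<open>I\<close>. The resolved module is \<open>I\<close> itself, not \<open>R/I\<close>.\<close>

definition graded_betti :: "nat \<Rightarrow> 'a::field mpoly set \<Rightarrow> nat \<Rightarrow> nat \<Rightarrow> nat" where
  "graded_betti n I i p =
     (THE c. \<exists>b e d. minimal_graded_free_resolution n I b e d \<and> b i p = c)"

end

theory Submission imports Defs begin

text \<open>
  Write \<open>J\<close> for the squarefree power. It is generated by the products of the vertices of \<open>k\<close>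
  pairwise disjoint intervals of length \<open>t\<close>. A first syzygy of a monomial ideal is a combination of
  syzygies \<open>(u/s) e\<^sub>s - (u/s') e\<^sub>s\<^sub>'\<close> with \<open>s\<close>, \<open>s'\<close> two generators dividing a monomial \<open>u\<close>.
  Such a syzygy is a multiple of one of smaller degree as soon as \<open>s\<close> and \<open>s'\<close> both divide a
  proper divisor of \<open>u\<close>, and syzygies can be added up along a chain. So no minimal first
  syzygy has degree \<open>p\<close> if, for every \<open>u\<close> of degree \<open>p\<close>, any two generators dividing \<open>u\<close> are joined
  by a chain in which neighbours have a common multiple properly dividing \<open>u\<close>
  (\<open>monomial_ideal_betti_1_zero\<close>).

  For the path ideal such chains come from sliding intervals to the left. Let the generators be given
  by the left endpoints \<open>a\<^sub>1 < \<dots> < a\<^sub>k\<close> and \<open>b\<^sub>1 < \<dots> < b\<^sub>k\<close>. The endpoints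
  \<open>c\<^sub>i = min(a\<^sub>i, b\<^sub>i)\<close> again describe a generator dividing \<open>u\<close>. From \<open>a\<close> one reaches \<open>c\<close> by moving one
  interval at a time, the leftmost misplaced one first, either one step to the left (if it overlaps its
  target) or directly onto its target (if it does not). Two neighbours in this chain have a union of
  \<open>kt + 1\<close> or of \<open>(k + 1)t\<close> elements, so their least common multiple is not \<open>u\<close> when the
  degree of \<open>u\<close> is neither of these numbers (\<open>slide_down\<close>).

  Betti numbers are defined as the ranks common to all minimal graded free resolutions. The criterion
  is therefore proved for an arbitrary minimal resolution (\<open>betti_1_zero_if_syzygies_decomposable\<close> is
  the Nakayama argument behind it), and a separate construction shows that a minimal resolution exists
  (\<open>minimal_resolution_exists\<close>). There every homogeneous component is a finite-dimensional vector
  space over the field, so that minimal generators can be chosen degree by degree.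
\<close>

abbreviation lookup :: "('b \<Rightarrow>\<^sub>0 'c::zero) \<Rightarrow> 'b \<Rightarrow> 'c" where
  "lookup \<equiv> Poly_Mapping.lookup"

abbreviation keys :: "('b \<Rightarrow>\<^sub>0 'c::zero) \<Rightarrow> 'b set" where
  "keys \<equiv> Poly_Mapping.keys"

abbreviation single :: "'b \<Rightarrow> 'c::zero \<Rightarrow> 'b \<Rightarrow>\<^sub>0 'c" where
  "single \<equiv> Poly_Mapping.single"

section \<open>Polynomials and graded free modules\<close>

lemma mdegree_superset:
  assumes "finite S" "keys m \<subseteq> S"
  shows "mdegree m = (\<Sum>i\<in>S. lookup m i)"
  unfolding mdegree_def using assms by (intro sum.mono_neutral_left) (auto simp: in_keys_iff)

lemma mdegree_add: "mdegree (m + m') = mdegree m + mdegree m'"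
proof -
  let ?S = "keys m \<union> keys m'"
  have "mdegree (m + m') = (\<Sum>i\<in>?S. lookup (m + m') i)"
    using keys_add[of m m'] by (intro mdegree_superset) auto
  also have "\<dots> = (\<Sum>i\<in>?S. lookup m i) + (\<Sum>i\<in>?S. lookup m' i)"
    by (simp add: lookup_add sum.distrib)
  also have "\<dots> = mdegree m + mdegree m'"
    by (simp add: mdegree_superset[of ?S])
  finally show ?thesis .
qed

lemma mdegree_0 [simp]: "mdegree 0 = 0"
  by (simp add: mdegree_def)

lemma mdegree_eq_0_iff: "mdegree m = 0 \<longleftrightarrow> m = 0"
  by (auto simp: mdegree_def in_keys_iff intro!: poly_mapping_eqI)

lemma keys_add_nat: "keys (a + b) = keys a \<union> keys b" for a b :: monomial
  by (auto simp: in_keys_iff lookup_add)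

lemma mpolys_0 [simp]: "0 \<in> mpolys n" by (simp add: mpolys_def)

lemma mpolys_single [simp]: "single m c \<in> mpolys n \<longleftrightarrow> c = 0 \<or> keys m \<subseteq> {1..n}"
  by (simp add: mpolys_def)

lemma mpolys_1 [simp]: "1 \<in> mpolys n" by (simp add: mpolys_def)

lemma mpolys_add [simp]: "f \<in> mpolys n \<Longrightarrow> g \<in> mpolys n \<Longrightarrow> f + g \<in> mpolys n"
  unfolding mpolys_def using keys_add[of f g] by blast

lemma mpolys_mult [simp]: "f \<in> mpolys n \<Longrightarrow> g \<in> mpolys n \<Longrightarrow> f * g \<in> mpolys n"
  unfolding mpolys_def using keys_mult[of f g] by (fastforce simp: keys_add_nat)

lemma mpolys_sum [simp]: "(\<And>i. i \<in> S \<Longrightarrow> f i \<in> mpolys n) \<Longrightarrow> sum f S \<in> mpolys n"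
  by (induction S rule: infinite_finite_induct) auto

lemma lookup_fvec_scale [simp]: "lookup (fvec_scale r v) x = r * lookup v x"
  by (simp add: fvec_scale_def Poly_Mapping.map.rep_eq when_def)

interpretation R: module "fvec_scale :: 'a::field mpoly \<Rightarrow> 'a fvec \<Rightarrow> 'a fvec"
  by unfold_locales (auto intro!: poly_mapping_eqI simp: lookup_add algebra_simps)

text \<open>
  Scaling by constants makes the free module a vector space, which gives access to the
  linear algebra of spans and bases.
\<close>
definition kscale :: "'a::field \<Rightarrow> 'a fvec \<Rightarrow> 'a fvec" where
  "kscale c v = fvec_scale (single 0 c) v"

interpretation K: vector_space "kscale :: 'a::field \<Rightarrow> 'a fvec \<Rightarrow> 'a fvec"
  by unfold_locales
    (auto simp: kscale_def R.scale_right_distrib R.scale_left_distrib single_add mult_single)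

lemma free_module_iff:
  "v \<in> free_module n b \<longleftrightarrow> (\<forall>x. lookup v x \<in> mpolys n \<and> (lookup v x \<noteq> 0 \<longrightarrow> x \<in> basis b))"
proof -
  have "lookup v x \<in> mpolys n \<longleftrightarrow> lookup v x = 0 \<or> lookup v x \<in> mpolys n" for x
    by (cases "lookup v x = 0") simp_all
  then show ?thesis unfolding free_module_def by (auto simp: in_keys_iff)
qed

lemma free_module_0 [simp]: "0 \<in> free_module n b" by (simp add: free_module_iff)

lemma free_module_add [simp]:
  "u \<in> free_module n b \<Longrightarrow> v \<in> free_module n b \<Longrightarrow> u + v \<in> free_module n b"
  unfolding free_module_iff lookup_add by (metis add.right_neutral mpolys_add)

lemma free_module_scale [simp]:
  "r \<in> mpolys n \<Longrightarrow> v \<in> free_module n b \<Longrightarrow> fvec_scale r v \<in> free_module n b"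
  by (force simp: free_module_iff)

lemma free_module_kscale [simp]: "v \<in> free_module n b \<Longrightarrow> kscale c v \<in> free_module n b"
  by (simp add: kscale_def)

lemma free_module_single [simp]:
  "r \<in> mpolys n \<Longrightarrow> x \<in> basis b \<Longrightarrow> single x r \<in> free_module n b"
  by (auto simp: free_module_iff lookup_single when_def)

lemma K_subspace_free_module: "K.subspace (free_module n b)"
  by (auto intro!: K.subspaceI)

lemma lin_fvec_superset:
  assumes "finite S" "keys v \<subseteq> S"
  shows "lin_fvec d v = (\<Sum>x\<in>S. fvec_scale (lookup v x) (d x))"
  unfolding lin_fvec_def using assms by (intro sum.mono_neutral_left) (auto simp: in_keys_iff)

lemma lin_fvec_add: "lin_fvec d (u + v) = lin_fvec d u + lin_fvec d v"
proof -
  let ?S = "keys u \<union> keys v"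
  have "lin_fvec d (u + v) = (\<Sum>x\<in>?S. fvec_scale (lookup (u + v) x) (d x))"
    using keys_add[of u v] by (intro lin_fvec_superset) auto
  also have "\<dots> = (\<Sum>x\<in>?S. fvec_scale (lookup u x) (d x)) + (\<Sum>x\<in>?S. fvec_scale (lookup v x) (d x))"
    by (simp add: lookup_add R.scale_left_distrib sum.distrib)
  also have "\<dots> = lin_fvec d u + lin_fvec d v"
    by (simp add: lin_fvec_superset[of ?S])
  finally show ?thesis .
qed

lemma lin_fvec_scale: "lin_fvec d (fvec_scale r v) = fvec_scale r (lin_fvec d v)"
proof -
  have "keys (fvec_scale r v) \<subseteq> keys v" by (auto simp: in_keys_iff)
  then have "lin_fvec d (fvec_scale r v) = (\<Sum>x\<in>keys v. fvec_scale (r * lookup v x) (d x))"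
    by (subst lin_fvec_superset[of "keys v"]) auto
  then show ?thesis by (simp add: lin_fvec_def R.scale_sum_right)
qed

lemma lin_fvec_0 [simp]: "lin_fvec d 0 = 0" by (simp add: lin_fvec_def)

lemma lin_fvec_kscale: "lin_fvec d (kscale c v) = kscale c (lin_fvec d v)"
  by (simp add: kscale_def lin_fvec_scale)

lemma lin_fvec_minus: "lin_fvec d (u - v) = lin_fvec d u - lin_fvec d v"
  by (metis add_diff_cancel diff_add_cancel lin_fvec_add)

lemma lin_fvec_sum: "lin_fvec d (sum f S) = (\<Sum>i\<in>S. lin_fvec d (f i))"
  by (induction S rule: infinite_finite_induct) (auto simp: lin_fvec_add)

lemma lin_fvec_single [simp]: "lin_fvec d (single x r) = fvec_scale r (d x)"
  by (simp add: lin_fvec_def)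

lemma fvec_eq_lin: "v = lin_fvec (\<lambda>x. single x 1) v"
proof (rule poly_mapping_eqI)
  fix y
  have "lookup (lin_fvec (\<lambda>x. single x 1) v) y = (\<Sum>x\<in>keys v. lookup v x * (1 when x = y))"
    by (simp add: lin_fvec_def lookup_sum lookup_single)
  also have "\<dots> = (\<Sum>x\<in>keys v. if x = y then lookup v x else 0)"
    by (intro sum.cong) (auto simp: when_def)
  also have "\<dots> = lookup v y"
    by (auto simp: sum.delta in_keys_iff)
  finally show "lookup v y = lookup (lin_fvec (\<lambda>x. single x 1) v) y" by simp
qed

text \<open>
  Monomials have nonnegative exponents, so a constant term of a product can only come from
  the constant terms of the factors. This is what makes \<open>(x\<^sub>1, \<dots>, x\<^sub>n) F\<close> a submodule.
\<close>
lemma const_coeff_mult: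
  fixes f g :: "'a::field mpoly"
  assumes "lookup g 0 = 0"
  shows "lookup (f * g) 0 = 0"
proof (rule ccontr)
  assume "lookup (f * g) 0 \<noteq> 0"
  then obtain a b where "0 = a + b" "b \<in> keys g"
    using keys_mult[of f g] by (force simp: in_keys_iff)
  then have "mdegree b = 0" by (metis add_eq_0_iff_both_eq_0 mdegree_add mdegree_0)
  with \<open>b \<in> keys g\<close> assms show False by (simp add: mdegree_eq_0_iff in_keys_iff)
qed

text \<open>
  The homogeneous component of degree \<open>p\<close>: as the basis element \<open>(q, j)\<close> has degree \<open>q\<close>, its
  coefficient keeps the monomials of degree \<open>p - q\<close>.
\<close>

definition hcomp :: "nat \<Rightarrow> 'a::field fvec \<Rightarrow> 'a fvec" where
  "hcomp p v = Abs_poly_mapping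
     (\<lambda>x. Abs_poly_mapping (\<lambda>m. lookup (lookup v x) m when fst x + mdegree m = p))"

lemma lookup_hcomp:
  "lookup (lookup (hcomp p v) x) m = (lookup (lookup v x) m when fst x + mdegree m = p)"
proof -
  have fin: "finite {m. (lookup (lookup v x) m when fst x + mdegree m = p) \<noteq> 0}" for x
    by (rule finite_subset[OF _ finite_keys[of "lookup v x"]]) (auto simp: in_keys_iff)
  have "finite {x. Abs_poly_mapping (\<lambda>m. lookup (lookup v x) m when fst x + mdegree m = p) \<noteq> 0}"
    by (rule finite_subset[OF _ finite_keys[of v]]) (auto simp: in_keys_iff)
  then show ?thesis
    unfolding hcomp_def using fin by (subst lookup_Abs_poly_mapping) auto
qed

lemma fvec_eqI: "(\<And>x m. lookup (lookup u x) m = lookup (lookup v x) m) \<Longrightarrow> u = v"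
  by (intro poly_mapping_eqI)

lemma fvec_homogeneous_iff:
  "fvec_homogeneous p v \<longleftrightarrow> (\<forall>x m. lookup (lookup v x) m \<noteq> 0 \<longrightarrow> fst x + mdegree m = p)"
proof -
  have "lookup (lookup v x) m \<noteq> 0 \<longleftrightarrow> x \<in> keys v \<and> m \<in> keys (lookup v x)" for x m
    by (auto simp: in_keys_iff)
  then show ?thesis unfolding fvec_homogeneous_def by blast
qed

lemma hcomp_homogeneous: "fvec_homogeneous q v \<Longrightarrow> hcomp p v = (if p = q then v else 0)"
  by (rule fvec_eqI) (auto simp del: split_paired_All simp: lookup_hcomp fvec_homogeneous_iff when_def)

lemma homogeneous_hcomp [simp]: "fvec_homogeneous p (hcomp p v)"
  by (auto simp: fvec_homogeneous_iff lookup_hcomp)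

lemma hcomp_add: "hcomp p (u + v) = hcomp p u + hcomp p v"
  by (rule fvec_eqI) (simp add: lookup_hcomp lookup_add when_add_distrib)

lemma hcomp_0 [simp]: "hcomp p 0 = 0"
  by (rule fvec_eqI) (simp add: lookup_hcomp)

lemma hcomp_sum: "hcomp p (sum f S) = (\<Sum>i\<in>S. hcomp p (f i))"
  by (induction S rule: infinite_finite_induct) (auto simp: hcomp_add)

lemma hcomp_free_module [simp]:
  assumes "v \<in> free_module n b"
  shows "hcomp p v \<in> free_module n b"
proof -
  have "lookup (hcomp p v) x = 0" if "lookup v x = 0" for x
    by (rule poly_mapping_eqI) (simp add: lookup_hcomp that)
  moreover have "keys (lookup (hcomp p v) x) \<subseteq> keys (lookup v x)" for x
    by (auto simp: in_keys_iff lookup_hcomp)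
  ultimately show ?thesis
    using assms unfolding free_module_iff mpolys_def by blast
qed

lemma hcomp_decompose: obtains P where "finite P" "v = (\<Sum>p\<in>P. hcomp p v)"
proof
  let ?P = "(\<Union>x\<in>keys v. (\<lambda>m. fst x + mdegree m) ` keys (lookup v x))"
  show "finite ?P" by auto
  show "v = (\<Sum>p\<in>?P. hcomp p v)"
  proof (rule fvec_eqI)
    fix x m
    have "fst x + mdegree m \<in> ?P" if "lookup (lookup v x) m \<noteq> 0"
    proof -
      from that have "x \<in> keys v" "m \<in> keys (lookup v x)" by (auto simp: in_keys_iff)
      then show ?thesis by blast
    qed
    then show "lookup (lookup v x) m = lookup (lookup (\<Sum>p\<in>?P. hcomp p v) x) m"
      using \<open>finite ?P\<close> by (auto simp: lookup_sum lookup_hcomp when_def sum.delta')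
  qed
qed

lemma homogeneous_single [simp]: "homogeneous d (single m c) \<longleftrightarrow> c = 0 \<or> mdegree m = d"
  by (simp add: homogeneous_def)

lemma homogeneous_mult:
  "homogeneous a f \<Longrightarrow> homogeneous b g \<Longrightarrow> homogeneous (a + b) (f * g)"
  unfolding homogeneous_def using keys_mult[of f g] by (fastforce simp: mdegree_add)

lemma fvec_homogeneous_coeffwise:
  "fvec_homogeneous p v \<longleftrightarrow>
     (\<forall>x. lookup v x = 0 \<or> fst x \<le> p \<and> homogeneous (p - fst x) (lookup v x))"
  (is "_ \<longleftrightarrow> ?R")
proof
  assume h: "fvec_homogeneous p v"
  show ?R
  proof (intro allI disjCI)
    fix x assume n: "\<not> (fst x \<le> p \<and> homogeneous (p - fst x) (lookup v x))"
    have "lookup (lookup v x) m = 0" for m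
    proof (rule ccontr)
      assume "lookup (lookup v x) m \<noteq> 0"
      with h have p: "p = fst x + mdegree m" unfolding fvec_homogeneous_iff by blast
      have "homogeneous (p - fst x) (lookup v x)"
        unfolding homogeneous_def in_keys_iff
      proof (intro ballI)
        fix k assume "k \<in> keys (lookup v x)"
        then have "fst x + mdegree k = p"
          using h unfolding fvec_homogeneous_iff in_keys_iff by blast
        then show "mdegree k = p - fst x" by simp
      qed
      moreover have "fst x \<le> p" using p by simp
      ultimately show False using n by blast
    qed
    then show "lookup v x = 0" by (intro poly_mapping_eqI) simp
  qed
next
  assume r: ?R
  show "fvec_homogeneous p v"
    unfolding fvec_homogeneous_iff
  proof (intro allI impI)
    fix x m assume nz: "lookup (lookup v x) m \<noteq> 0"
    then have "lookup v x \<noteq> 0" by auto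
    with r have "fst x \<le> p" "homogeneous (p - fst x) (lookup v x)" by blast+
    with nz show "fst x + mdegree m = p" by (auto simp: homogeneous_def in_keys_iff)
  qed
qed

lemma fvec_homogeneous_0 [simp]: "fvec_homogeneous p 0" by (simp add: fvec_homogeneous_def)

lemma fvec_homogeneous_add [simp]:
  "fvec_homogeneous p u \<Longrightarrow> fvec_homogeneous p v \<Longrightarrow> fvec_homogeneous p (u + v)"
  unfolding fvec_homogeneous_iff lookup_add by (metis add.right_neutral)

lemma fvec_homogeneous_scale:
  assumes "homogeneous a r" "fvec_homogeneous b v"
  shows "fvec_homogeneous (a + b) (fvec_scale r v)"
  unfolding fvec_homogeneous_coeffwise
proof (intro allI disjCI)
  fix x assume nz: "\<not> (fst x \<le> a + b \<and> homogeneous (a + b - fst x) (lookup (fvec_scale r v) x))"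
  show "lookup (fvec_scale r v) x = 0"
  proof (cases "lookup v x = 0")
    case False
    with assms(2) have "fst x \<le> b" "homogeneous (b - fst x) (lookup v x)"
      unfolding fvec_homogeneous_coeffwise by blast+
    with homogeneous_mult[OF assms(1) this(2)] nz show ?thesis by simp
  qed simp
qed

lemma fvec_homogeneous_kscale [simp]: "fvec_homogeneous p v \<Longrightarrow> fvec_homogeneous p (kscale c v)"
  using fvec_homogeneous_scale[of 0 "single 0 c" p v] by (simp add: kscale_def)

lemma K_subspace_homogeneous: "K.subspace {v. fvec_homogeneous p v}"
  by (auto intro!: K.subspaceI)

lemma fvec_homogeneous_lin:
  assumes "\<And>x. x \<in> keys v \<Longrightarrow> fvec_homogeneous (fst x) (d x)" "fvec_homogeneous p v"
  shows "fvec_homogeneous p (lin_fvec d v)"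
proof -
  have "fvec_homogeneous p (fvec_scale (lookup v x) (d x))" if "x \<in> keys v" for x
  proof -
    from that assms(2) have "fst x \<le> p" "homogeneous (p - fst x) (lookup v x)"
      unfolding fvec_homogeneous_coeffwise in_keys_iff by blast+
    with fvec_homogeneous_scale[OF this(2) assms(1)[OF that]] show ?thesis by simp
  qed
  then show ?thesis
    unfolding lin_fvec_def by (rule K.subspace_sum[OF K_subspace_homogeneous, unfolded mem_Collect_eq])
qed

lemma keys_subset_basis: "v \<in> free_module n b \<Longrightarrow> x \<in> keys v \<Longrightarrow> x \<in> basis b"
  by (auto simp: free_module_def)

text \<open>
  A linear map of degree \<open>0\<close> sends the homogeneous decomposition of \<open>v\<close> to a decomposition of its
  image, and homogeneous decompositions are unique. In particular kernels are graded.
\<close>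
lemma hcomp_lin_fvec:
  assumes "\<And>x. x \<in> basis b \<Longrightarrow> fvec_homogeneous (fst x) (d x)" "v \<in> free_module n b"
  shows "hcomp p (lin_fvec d v) = lin_fvec d (hcomp p v)"
proof -
  have hom: "fvec_homogeneous q (lin_fvec d (hcomp q v))" for q
    by (rule fvec_homogeneous_lin[OF assms(1) homogeneous_hcomp])
      (rule keys_subset_basis[OF hcomp_free_module[OF assms(2)]])
  obtain P where P: "finite P" "v = (\<Sum>q\<in>P. hcomp q v)" by (rule hcomp_decompose)
  have "hcomp p (lin_fvec d v) = hcomp p (\<Sum>q\<in>P. lin_fvec d (hcomp q v))"
    by (subst P(2)) (simp add: lin_fvec_sum)
  also have "\<dots> = (\<Sum>q\<in>P. if p = q then lin_fvec d (hcomp q v) else 0)"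
    by (simp add: hcomp_sum hcomp_homogeneous[OF hom])
  also have "\<dots> = lin_fvec d (\<Sum>q\<in>P. hcomp p (hcomp q v))"
    unfolding lin_fvec_sum
    by (intro sum.cong) (auto simp: hcomp_homogeneous[OF homogeneous_hcomp])
  also have "(\<Sum>q\<in>P. hcomp p (hcomp q v)) = hcomp p v"
    by (subst (2) P(2)) (simp add: hcomp_sum)
  finally show ?thesis .
qed

section \<open>Graded submodules and their decomposable elements\<close>

definition graded_submodule :: "nat \<Rightarrow> (nat \<Rightarrow> nat) \<Rightarrow> 'a::field fvec set \<Rightarrow> bool" where
  "graded_submodule n b M \<longleftrightarrow>
     M \<subseteq> free_module n b \<and> 0 \<in> M \<and>
     (\<forall>u\<in>M. \<forall>v\<in>M. u + v \<in> M) \<and>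
     (\<forall>r\<in>mpolys n. \<forall>v\<in>M. fvec_scale r v \<in> M) \<and>
     (\<forall>v\<in>M. \<forall>p. hcomp p v \<in> M)"

text \<open>
  The component of degree \<open>p\<close> of \<open>(x\<^sub>1, \<dots>, x\<^sub>n) M\<close>. An element of degree \<open>p\<close> outside it is needed in
  every homogeneous generating set.
\<close>
definition decomposables :: "nat \<Rightarrow> 'a::field fvec set \<Rightarrow> nat \<Rightarrow> 'a fvec set" where
  "decomposables n M p = K.span
     {fvec_scale r u | r u q. q < p \<and> r \<in> mpolys n \<and> homogeneous (p - q) r \<and>
        u \<in> M \<and> fvec_homogeneous q u}"

lemma graded_submodule_subspace:
  assumes "graded_submodule n b M"
  shows "K.subspace M"
  using assms by (intro K.subspaceI) (auto simp: graded_submodule_def kscale_def)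

lemma decomposables_subset:
  assumes "graded_submodule n b M"
  shows "decomposables n M p \<subseteq> M \<inter> {v. fvec_homogeneous p v}"
  unfolding decomposables_def
proof (rule K.span_minimal)
  show "K.subspace (M \<inter> {v. fvec_homogeneous p v})"
    by (intro K.subspace_inter graded_submodule_subspace[OF assms] K_subspace_homogeneous)
next
  have "fvec_homogeneous p (fvec_scale r u)"
    if "q < p" "homogeneous (p - q) r" "fvec_homogeneous q u" for r u q
    using fvec_homogeneous_scale[OF that(2,3)] that(1) by simp
  then show "{fvec_scale r u | r u q. q < p \<and> r \<in> mpolys n \<and> homogeneous (p - q) r \<and>
      u \<in> M \<and> fvec_homogeneous q u} \<subseteq> M \<inter> {v. fvec_homogeneous p v}"
    using assms unfolding graded_submodule_def by auto
qed

lemma graded_submodule_kernel: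
  assumes hom: "\<And>x. x \<in> basis b \<Longrightarrow> fvec_homogeneous (fst x) (d x)"
  shows "graded_submodule n b {v \<in> free_module n b. lin_fvec d v = 0}"
proof -
  have "lin_fvec d (hcomp p v) = 0" if "v \<in> free_module n b" "lin_fvec d v = 0" for p v
    using hcomp_lin_fvec[OF hom that(1), of p] that(2) by simp
  then show ?thesis
    by (simp add: graded_submodule_def lin_fvec_add lin_fvec_scale)
qed

lemma finite_monomials_of_degree: "finite {m :: monomial. keys m \<subseteq> {1..n} \<and> mdegree m \<le> p}"
proof (rule finite_imageD)
  have "lookup m i \<le> p" if "mdegree m \<le> p" for m :: monomial and i
  proof (cases "i \<in> keys m")
    case True
    then have "lookup m i \<le> mdegree m"
      unfolding mdegree_def by (intro member_le_sum) auto
    with that show ?thesis by simp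
  qed (simp add: in_keys_iff)
  then have "lookup ` {m :: monomial. keys m \<subseteq> {1..n} \<and> mdegree m \<le> p}
      \<subseteq> {f. \<forall>i. (i \<in> {1..n} \<longrightarrow> f i \<in> {..p}) \<and> (i \<notin> {1..n} \<longrightarrow> f i = 0)}"
    by (auto simp: in_keys_iff)
  moreover have "finite {f :: nat \<Rightarrow> nat. \<forall>i. (i \<in> {1..n} \<longrightarrow> f i \<in> {..p}) \<and> (i \<notin> {1..n} \<longrightarrow> f i = 0)}"
    by (intro finite_set_of_finite_funs) auto
  ultimately show "finite (lookup ` {m :: monomial. keys m \<subseteq> {1..n} \<and> mdegree m \<le> p})"
    by (rule finite_subset)
  show "inj_on lookup {m :: monomial. keys m \<subseteq> {1..n} \<and> mdegree m \<le> p}"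
    by (auto intro: inj_onI poly_mapping_eqI)
qed

lemma mpoly_expand: "f = (\<Sum>m\<in>keys f. single m (lookup f m))"
  by (rule poly_mapping_eqI) (auto simp: lookup_sum lookup_single when_def sum.delta in_keys_iff)

lemma fvec_scale_single: "fvec_scale r (single x s) = single x (r * s)"
  by (rule poly_mapping_eqI) (auto simp: lookup_single when_def)

lemma single_sum: "single x (sum f S) = (\<Sum>i\<in>S. single x (f i))"
  by (induction S rule: infinite_finite_induct) (auto simp: single_add)

text \<open>
  In degree \<open>p\<close> only the finitely many basis elements of degree at most \<open>p\<close> occur, each
  with one of finitely many monomials. The rank of the free module itself may be infinite.
\<close>
lemma homogeneous_part_finite_dimensional:
  obtains T where "finite T" "free_module n b \<inter> {v. fvec_homogeneous p v} \<subseteq> K.span T"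
proof
  let ?X = "{x \<in> basis b. fst x \<le> p}"
  let ?Mon = "{m :: monomial. keys m \<subseteq> {1..n} \<and> mdegree m \<le> p}"
  let ?T = "(\<lambda>(x, m). single x (monom m)) ` (?X \<times> ?Mon)"
  have "?X \<subseteq> (\<Union>q\<in>{..p}. {q} \<times> {..<b q})" by (auto simp: basis_def)
  then have "finite ?X" by (rule finite_subset) auto
  then show "finite ?T" using finite_monomials_of_degree[of n p] by auto
  show "free_module n b \<inter> {v. fvec_homogeneous p v} \<subseteq> K.span ?T"
  proof
    fix v assume v: "v \<in> free_module n b \<inter> {v. fvec_homogeneous p v}"
    have "v = (\<Sum>x\<in>keys v. single x (\<Sum>m\<in>keys (lookup v x). single m (lookup (lookup v x) m)))"
      using mpoly_expand[of v] by (simp flip: mpoly_expand)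
    also have "\<dots> = (\<Sum>x\<in>keys v. \<Sum>m\<in>keys (lookup v x). kscale (lookup (lookup v x) m) (single x (monom m)))"
      by (simp add: single_sum kscale_def fvec_scale_single monom_def mult_single)
    also have "\<dots> \<in> K.span ?T"
    proof (intro K.span_sum K.span_scale K.span_base)
      fix x m assume xm: "x \<in> keys v" "m \<in> keys (lookup v x)"
      have "fst x + mdegree m = p" using v xm unfolding fvec_homogeneous_def by auto
      moreover have "keys m \<subseteq> {1..n}" using v xm unfolding free_module_def mpolys_def by auto
      moreover have "x \<in> basis b" using v xm unfolding free_module_def by auto
      ultimately have "(x, m) \<in> ?X \<times> ?Mon" by auto
      then show "single x (monom m) \<in> ?T" by (auto intro!: image_eqI[of _ _ "(x, m)"])
    qed
    finally show "v \<in> K.span ?T" .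
  qed
qed

section \<open>Existence of minimal graded free resolutions\<close>

text \<open>
  Extend a basis of the decomposables to a basis of the whole component; the added vectors are the
  minimal generators in degree \<open>p\<close>.
\<close>
lemma complement_of_decomposables:
  fixes M :: "'a::field fvec set"
  assumes M: "graded_submodule n b M"
  obtains B where "finite B" "B \<subseteq> M \<inter> {v. fvec_homogeneous p v}"
    "M \<inter> {v. fvec_homogeneous p v} \<subseteq> K.span (decomposables n M p \<union> B)"
    "\<And>c. (\<Sum>v\<in>B. kscale (c v) v) \<in> decomposables n M p \<Longrightarrow> \<forall>v\<in>B. c v = 0"
proof -
  let ?N = "decomposables n M p" and ?M = "M \<inter> {v. fvec_homogeneous p v}"
  have NM: "?N \<subseteq> ?M" by (rule decomposables_subset[OF M])
  obtain A where A: "A \<subseteq> ?N" "K.independent A" "?N \<subseteq> K.span A"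
    by (rule K.maximal_independent_subset)
  obtain C where C: "A \<subseteq> C" "C \<subseteq> ?M" "K.independent C" "?M \<subseteq> K.span C"
    using K.maximal_independent_subset_extend[of A ?M] A NM by blast
  obtain T :: "'a fvec set" where T: "finite T" "free_module n b \<inter> {v. fvec_homogeneous p v} \<subseteq> K.span T"
    by (rule homogeneous_part_finite_dimensional)
  have "C \<subseteq> K.span T"
    using C(2) T(2) M unfolding graded_submodule_def by blast
  with T(1) C(3) have finC: "finite C" using K.independent_span_bound by blast
  then have finA: "finite A" using C(1) finite_subset by blast
  show thesis
  proof
    show "finite (C - A)" using finC by simp
    show "C - A \<subseteq> ?M" using C(2) by blast
    have "C \<subseteq> ?N \<union> (C - A)" using A(1) by blast
    then show "?M \<subseteq> K.span (?N \<union> (C - A))" using C(4) K.span_mono by blast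
  next
    fix c assume "(\<Sum>v\<in>C - A. kscale (c v) v) \<in> ?N"
    with A(3) have "(\<Sum>v\<in>C - A. kscale (c v) v) \<in> K.span A" by blast
    then obtain f where f: "(\<Sum>v\<in>C - A. kscale (c v) v) = (\<Sum>v\<in>A. kscale (f v) v)"
      unfolding K.span_finite[OF finA] by blast
    define g where "g v = (if v \<in> A then - f v else c v)" for v
    have "(\<Sum>v\<in>C. kscale (g v) v) = (\<Sum>v\<in>C - A. kscale (g v) v) + (\<Sum>v\<in>A. kscale (g v) v)"
      using sum.subset_diff[OF C(1) finC] .
    also have "\<dots> = (\<Sum>v\<in>C - A. kscale (c v) v) - (\<Sum>v\<in>A. kscale (f v) v)"
      by (simp add: g_def sum_negf)
    also have "\<dots> = 0" using f by simp
    finally have "g v = 0" if "v \<in> C" for v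
      using K.independentD[OF C(3) finC subset_refl] that by blast
    then show "\<forall>v\<in>C - A. c v = 0" unfolding g_def by (metis DiffE)
  qed
qed

lemma lin_fvec_subspace_image: "K.subspace (lin_fvec d ` free_module n b)"
proof (rule K.subspaceI)
  show "0 \<in> lin_fvec d ` free_module n b" by (rule image_eqI[of _ _ 0]) auto
next
  fix x y assume "x \<in> lin_fvec d ` free_module n b" "y \<in> lin_fvec d ` free_module n b"
  then show "x + y \<in> lin_fvec d ` free_module n b"
    by (auto simp flip: lin_fvec_add intro!: imageI)
next
  fix c x assume "x \<in> lin_fvec d ` free_module n b"
  then show "kscale c x \<in> lin_fvec d ` free_module n b"
    by (auto simp flip: lin_fvec_kscale intro!: imageI)
qed

lemma homogeneous_degree_0: "homogeneous 0 r \<Longrightarrow> r = single 0 (lookup r 0)"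
  by (rule poly_mapping_eqI)
    (auto simp: homogeneous_def mdegree_eq_0_iff lookup_single when_def in_keys_iff)

lemma lin_fvec_mem:
  assumes M: "graded_submodule n b M" and d: "\<And>x. x \<in> basis b' \<Longrightarrow> d x \<in> M"
    and v: "v \<in> free_module n b'"
  shows "lin_fvec d v \<in> M"
  unfolding lin_fvec_def
proof (rule K.subspace_sum[OF graded_submodule_subspace[OF M]])
  fix x assume "x \<in> keys v"
  with v have "lookup v x \<in> mpolys n" "x \<in> basis b'" by (auto simp: free_module_def)
  with d M show "fvec_scale (lookup v x) (d x) \<in> M" unfolding graded_submodule_def by blast
qed

text \<open>
  Take complements \<open>B p\<close> of the decomposables in all degrees. They generate \<open>M\<close> by induction on the
  degree. In a relation between them, the constant coefficients belong to generators of the same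
  degree \<open>p\<close> as the relation, while all other terms are decomposable. So the constant coefficients give
  a relation between the elements of \<open>B p\<close> modulo decomposables and vanish. Hence the kernel of the
  presentation lies in \<open>(x\<^sub>1, \<dots>, x\<^sub>n) F\<close>, as minimality of the next differential requires.
\<close>
lemma minimal_generators_exist:
  fixes M :: "'a::field fvec set"
  assumes M: "graded_submodule n b M"
  obtains b' d where
    "\<And>x. x \<in> basis b' \<Longrightarrow> d x \<in> M \<and> fvec_homogeneous (fst x) (d x)"
    "lin_fvec d ` free_module n b' = M"
    "\<And>w x. w \<in> free_module n b' \<Longrightarrow> lin_fvec d w = 0 \<Longrightarrow> lookup (lookup w x) 0 = 0"
proof -
  let ?N = "decomposables n M" and ?M = "\<lambda>p. M \<inter> {v. fvec_homogeneous p v}"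
  define compl where "compl p B \<longleftrightarrow> finite B \<and> B \<subseteq> ?M p \<and> ?M p \<subseteq> K.span (?N p \<union> B) \<and>
      (\<forall>c. (\<Sum>v\<in>B. kscale (c v) v) \<in> ?N p \<longrightarrow> (\<forall>v\<in>B. c v = 0))" for p B
  have "\<exists>B. compl p B" for p
    unfolding compl_def by (rule complement_of_decomposables[OF M, of p]) blast
  then obtain B where "\<And>p. compl p (B p)" by metis
  then have B: "\<And>p. finite (B p)" "\<And>p. B p \<subseteq> ?M p" "\<And>p. ?M p \<subseteq> K.span (?N p \<union> B p)"
      "\<And>p c. (\<Sum>v\<in>B p. kscale (c v) v) \<in> ?N p \<Longrightarrow> \<forall>v\<in>B p. c v = 0"
    unfolding compl_def by blast+
  have "\<exists>h. bij_betw h {0..<card (B p)} (B p)" for p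
    using ex_bij_betw_nat_finite[OF B(1)] .
  then obtain h where h: "\<And>p. bij_betw (h p) {0..<card (B p)} (B p)" by metis
  define b' where "b' p = card (B p)" for p
  define d where "d x = h (fst x) (snd x)" for x
  have dB: "d x \<in> B (fst x)" if "x \<in> basis b'" for x
    using that bij_betwE[OF h] by (auto simp: basis_def b'_def d_def)
  have Bd: "v \<in> d ` ({p} \<times> {0..<b' p})" if "v \<in> B p" for v p
    using that bij_betw_imp_surj_on[OF h[of p]] by (force simp: b'_def d_def)
  have dM: "d x \<in> M \<and> fvec_homogeneous (fst x) (d x)" if "x \<in> basis b'" for x
    using dB[OF that] B(2) by blast
  let ?im = "lin_fvec d ` free_module n b'"
  have part: "?M p \<subseteq> ?im" for p
  proof (induction p rule: less_induct)
    case (less p)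
    have "?N p \<subseteq> ?im"
      unfolding decomposables_def
    proof (rule K.span_minimal[OF _ lin_fvec_subspace_image], safe)
      fix r :: "'a mpoly" and u q
      assume *: "q < p" "r \<in> mpolys n" "homogeneous (p - q) r" "u \<in> M" "fvec_homogeneous q u"
      with less obtain w where "w \<in> free_module n b'" "u = lin_fvec d w" by blast
      with * show "fvec_scale r u \<in> ?im"
        by (intro image_eqI[of _ _ "fvec_scale r w"]) (auto simp: lin_fvec_scale)
    qed
    moreover have "B p \<subseteq> ?im"
    proof
      fix v assume "v \<in> B p"
      then obtain x where x: "x \<in> {p} \<times> {0..<b' p}" "v = d x" using Bd by blast
      then show "v \<in> ?im"
        by (intro image_eqI[of _ _ "single x 1"]) (auto simp: basis_def)
    qed
    ultimately have "K.span (?N p \<union> B p) \<subseteq> ?im"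
      by (intro K.span_minimal lin_fvec_subspace_image) blast
    with B(3) show ?case by blast
  qed
  have "?im = M"
  proof
    show "?im \<subseteq> M" using lin_fvec_mem[OF M] dM by blast
    show "M \<subseteq> ?im"
    proof
      fix v assume v: "v \<in> M"
      obtain P where P: "finite P" "v = (\<Sum>p\<in>P. hcomp p v)" by (rule hcomp_decompose)
      have "hcomp p v \<in> ?im" for p
        using part[of p] v M unfolding graded_submodule_def by auto
      then show "v \<in> ?im"
        by (subst P(2)) (intro K.subspace_sum[OF lin_fvec_subspace_image])
    qed
  qed
  moreover have "lookup (lookup w x) 0 = 0"
    if w: "w \<in> free_module n b'" "lin_fvec d w = 0" for w x
  proof (cases "x \<in> basis b'")
    case False
    with w show ?thesis unfolding free_module_iff by (metis lookup_zero)
  next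
    case True
    \<comment> \<open>The constant coefficient at \<open>x\<close> is already that of the component of degree \<open>fst x\<close>.\<close>
    define p where "p = fst x"
    define w' where "w' = hcomp p w"
    have w': "w' \<in> free_module n b'" "lin_fvec d w' = 0" "fvec_homogeneous p w'"
      using w hcomp_lin_fvec[of b' d w n p] dM by (auto simp: w'_def)
    let ?S = "{p} \<times> {0..<b' p}"
    define c where "c j = lookup (lookup w' (p, j)) 0" for j
    have low: "fvec_scale (lookup w' y) (d y) \<in> ?N p" if y: "y \<in> keys w' - ?S" for y
    proof -
      have yb: "y \<in> basis b'" "lookup w' y \<in> mpolys n"
        using y w'(1) by (auto simp: free_module_def)
      have "lookup w' y \<noteq> 0" using y by (auto simp: in_keys_iff)
      then have hom: "fst y \<le> p" "homogeneous (p - fst y) (lookup w' y)"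
        using w'(3) unfolding fvec_homogeneous_coeffwise by blast+
      have "fst y \<noteq> p" using y yb(1) by (auto simp: basis_def)
      with hom(1) have "fst y < p" by simp
      with hom(2) yb(2) dM[OF yb(1)] show ?thesis
        unfolding decomposables_def by (intro K.span_base) blast
    qed
    have const: "lookup w' (p, j) = single 0 (c j)" for j
    proof -
      have "lookup w' (p, j) = 0 \<or> homogeneous (p - fst (p, j)) (lookup w' (p, j))"
        using w'(3) unfolding fvec_homogeneous_coeffwise by blast
      then show ?thesis
        using homogeneous_degree_0[of "lookup w' (p, j)"] by (auto simp: c_def)
    qed
    have "0 = lin_fvec d w'" using w'(2) by simp
    also have "\<dots> = (\<Sum>y\<in>(keys w' - ?S) \<union> ?S. fvec_scale (lookup w' y) (d y))"
      by (rule lin_fvec_superset) auto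
    also have "\<dots> = (\<Sum>y\<in>keys w' - ?S. fvec_scale (lookup w' y) (d y))
        + (\<Sum>y\<in>?S. fvec_scale (lookup w' y) (d y))"
      by (rule sum.union_disjoint) auto
    also have "(\<Sum>y\<in>?S. fvec_scale (lookup w' y) (d y)) = (\<Sum>j\<in>{0..<b' p}. kscale (c j) (h p j))"
      by (simp add: sum.cartesian_product' d_def const kscale_def)
    also have "\<dots> = (\<Sum>j\<in>{0..<b' p}. kscale (c (inv_into {0..<b' p} (h p) (h p j))) (h p j))"
      using bij_betw_inv_into_left[OF h[of p]] by (intro sum.cong) (auto simp: b'_def)
    also have "\<dots> = (\<Sum>v\<in>B p. kscale (c (inv_into {0..<b' p} (h p) v)) v)"
      using sum.reindex_bij_betw[OF h[of p], of "\<lambda>v. kscale (c (inv_into {0..<b' p} (h p) v)) v"]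
      by (simp add: b'_def)
    finally have "(\<Sum>v\<in>B p. kscale (c (inv_into {0..<b' p} (h p) v)) v)
        = - (\<Sum>y\<in>keys w' - ?S. fvec_scale (lookup w' y) (d y))"
      by (simp add: eq_neg_iff_add_eq_0 add.commute)
    also have "\<dots> \<in> ?N p"
      using low unfolding decomposables_def by (intro K.span_neg K.span_sum)
    finally have zero: "c (inv_into {0..<b' p} (h p) v) = 0" if "v \<in> B p" for v
      using B(4)[of "\<lambda>v. c (inv_into {0..<b' p} (h p) v)" p] that by blast
    obtain j where j: "x = (p, j)" "j < b' p" using True by (auto simp: basis_def p_def)
    then have "c j = 0"
      using zero[of "h p j"] bij_betwE[OF h[of p]] bij_betw_inv_into_left[OF h[of p]]
      by (auto simp: b'_def)
    then show ?thesis by (simp add: c_def w'_def lookup_hcomp j)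
  qed
  ultimately show thesis using that dM by blast
qed

text \<open>
  The ring as the free module of rank one with its generator in degree \<open>0\<close>. Under this
  identification the augmentation \<open>e\<close> becomes one more map between free modules.
\<close>
abbreviation embed :: "'a::field mpoly \<Rightarrow> 'a fvec" where
  "embed f \<equiv> single (0, 0) f"

lemma lin_poly_eq_lin_fvec:
  "embed (lin_poly e v) = lin_fvec (\<lambda>x. embed (e x)) v"
  by (simp add: lin_poly_def lin_fvec_def single_sum fvec_scale_single)

lemma fvec_homogeneous_embedded [simp]:
  "fvec_homogeneous p (embed f) \<longleftrightarrow> homogeneous p f"
  by (simp add: fvec_homogeneous_def homogeneous_def)

lemma single_eq_iff [simp]: "single x a = single x b \<longleftrightarrow> a = b"
  by (metis lookup_single_eq)

lemma single_eq_0_iff [simp]: "single x a = 0 \<longleftrightarrow> a = 0"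
  by (metis lookup_single_eq single_zero)

text \<open>
  Start with \<open>J\<close> as a graded submodule of the ring and repeatedly present the current graded
  submodule by minimal generators, passing to the kernel of the presentation.
\<close>
lemma minimal_resolution_exists:
  fixes J :: "'a::field mpoly set"
  assumes J: "graded_submodule n (\<lambda>q. if q = 0 then 1 else 0) (embed ` J)"
  obtains b e d where "minimal_graded_free_resolution n J b e d"
proof -
  let ?\<delta> = "\<lambda>q::nat. if q = 0 then 1 else 0 :: nat"
  define good where "good b M b' d \<longleftrightarrow>
    (\<forall>x\<in>basis b'. d x \<in> M \<and> fvec_homogeneous (fst x) (d x)) \<and>
    lin_fvec d ` free_module n b' = M \<and>
    (\<forall>w\<in>free_module n b'. lin_fvec d w = 0 \<longrightarrow> (\<forall>x. lookup (lookup w x) 0 = 0))"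
    for b :: "nat \<Rightarrow> nat" and M :: "'a fvec set" and b' :: "nat \<Rightarrow> nat" and d
  have "\<exists>b' d. graded_submodule n b M \<longrightarrow> good b M b' d" for b M
  proof (cases "graded_submodule n b M")
    case True
    show ?thesis
      by (rule minimal_generators_exist[OF True]) (unfold good_def, blast)
  qed simp
  then obtain B D where BD: "\<And>b M. graded_submodule n b M \<Longrightarrow> good b M (B b M) (D b M)"
    by metis
  \<comment> \<open>A state \<open>(b, M)\<close> consists of the ranks of a free module and a submodule to be resolved in it.\<close>
  define step where "step s = (let b' = B (fst s) (snd s)
     in (b', {v \<in> free_module n b'. lin_fvec (D (fst s) (snd s)) v = 0}))" for s
  define S where "S i = (step ^^ i) (?\<delta>, embed ` J)" for i
  define b where "b i = B (fst (S i)) (snd (S i))" for i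
  define diff where "diff i = D (fst (S i)) (snd (S i))" for i
  have S0: "S 0 = (?\<delta>, embed ` J)" by (simp add: S_def)
  have SSuc: "S (Suc i) = (b i, {v \<in> free_module n (b i). lin_fvec (diff i) v = 0})" for i
    by (simp add: S_def step_def b_def diff_def Let_def)
  have graded: "graded_submodule n (fst (S i)) (snd (S i))" for i
  proof (induction i)
    case 0 then show ?case using J by (simp add: S0)
  next
    case (Suc i)
    then have "good (fst (S i)) (snd (S i)) (b i) (diff i)"
      unfolding b_def diff_def by (rule BD)
    then show ?case
      unfolding SSuc good_def by (auto intro!: graded_submodule_kernel)
  qed
  have good: "good (fst (S i)) (snd (S i)) (b i) (diff i)" for i
    unfolding b_def diff_def by (rule BD[OF graded])
  define e where "e x = lookup (diff 0 x) (0, 0)" for x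
  define d where "d i = diff (Suc i)" for i
  have e: "diff 0 x = embed (e x) \<and> e x \<in> J \<and> homogeneous (fst x) (e x)"
    if "x \<in> basis (b 0)" for x
  proof -
    have "diff 0 x \<in> embed ` J" "fvec_homogeneous (fst x) (diff 0 x)"
      using good[of 0] that by (auto simp: good_def S0)
    then show ?thesis by (auto simp: e_def)
  qed
  have JR: "J \<subseteq> mpolys n"
  proof
    fix f assume "f \<in> J"
    then have "embed f \<in> free_module n ?\<delta>" using J by (auto simp: graded_submodule_def)
    then have "lookup (embed f) (0, 0) \<in> mpolys n"
      unfolding free_module_iff by blast
    then show "f \<in> mpolys n" by simp
  qed
  have lin: "lin_fvec (diff 0) v = embed (lin_poly e v)" if "v \<in> free_module n (b 0)" for v
    unfolding lin_poly_eq_lin_fvec unfolding lin_fvec_def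
    by (rule sum.cong) (use e that in \<open>auto simp: free_module_def\<close>)
  have "minimal_graded_free_resolution n J b e d"
    unfolding minimal_graded_free_resolution_def
  proof (intro conjI allI ballI)
    fix x assume "x \<in> basis (b 0)"
    with e JR show "e x \<in> mpolys n" "homogeneous (fst x) (e x)" by blast+
  next
    fix i x assume x: "x \<in> basis (b (Suc i))"
    then show "d i x \<in> free_module n (b i)" "fvec_homogeneous (fst x) (d i x)"
      using good[of "Suc i"] by (auto simp: good_def SSuc d_def)
    fix y
    have "d i x \<in> {v \<in> free_module n (b i). lin_fvec (diff i) v = 0}"
      using good[of "Suc i"] x by (auto simp: good_def SSuc d_def)
    then show "lookup (lookup (d i x) y) 0 = 0"
      using good[of i] unfolding good_def by blast
  next
    have "embed ` lin_poly e ` free_module n (b 0) = embed ` J"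
      using good[of 0] lin by (auto simp: good_def S0 image_image cong: image_cong)
    then show "lin_poly e ` free_module n (b 0) = J"
      by (simp add: inj_image_eq_iff)
  next
    show "lin_fvec (d 0) ` free_module n (b 1) = {v \<in> free_module n (b 0). lin_poly e v = 0}"
      using good[of 1] lin by (auto simp: good_def SSuc d_def)
  next
    fix i
    show "lin_fvec (d (Suc i)) ` free_module n (b (Suc (Suc i))) =
        {v \<in> free_module n (b (Suc i)). lin_fvec (d i) v = 0}"
      using good[of "Suc (Suc i)"] by (auto simp: good_def SSuc d_def)
  qed
  then show thesis by (rule that)
qed

section \<open>First syzygies and minimality\<close>

lemma lin_poly_add: "lin_poly e (u + v) = lin_poly e u + lin_poly e v"
  using lin_fvec_add[of "\<lambda>x. embed (e x)" u v]
  by (simp flip: lin_poly_eq_lin_fvec single_add)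

lemma lin_poly_diff: "lin_poly e (u - v) = lin_poly e u - lin_poly e v"
  using lin_fvec_minus[of "\<lambda>x. embed (e x)" u v]
  by (simp flip: lin_poly_eq_lin_fvec single_diff)

lemma lin_poly_scale: "lin_poly e (fvec_scale r v) = r * lin_poly e v"
  using lin_fvec_scale[of "\<lambda>x. embed (e x)" r v]
  by (simp add: fvec_scale_single flip: lin_poly_eq_lin_fvec)

lemma lin_poly_single: "lin_poly e (single x r) = r * e x"
  by (simp add: lin_poly_def)

lemma lin_poly_sum: "lin_poly e (sum f S) = (\<Sum>i\<in>S. lin_poly e (f i))"
  by (induction S rule: infinite_finite_induct)
    (simp_all add: lin_poly_add, simp_all add: lin_poly_def)

lemma resolution_facts:
  assumes "minimal_graded_free_resolution n J b e d"
  shows resolution_e_hom: "x \<in> basis (b 0) \<Longrightarrow> homogeneous (fst x) (e x)"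
    and resolution_d_hom: "x \<in> basis (b (Suc i)) \<Longrightarrow> fvec_homogeneous (fst x) (d i x)"
    and resolution_image_e: "lin_poly e ` free_module n (b 0) = J"
    and resolution_image_d0:
      "lin_fvec (d 0) ` free_module n (b 1) = {v \<in> free_module n (b 0). lin_poly e v = 0}"
    and resolution_image_d: "lin_fvec (d (Suc i)) ` free_module n (b (Suc (Suc i))) =
        {v \<in> free_module n (b (Suc i)). lin_fvec (d i) v = 0}"
    and resolution_minimal: "x \<in> basis (b (Suc i)) \<Longrightarrow> lookup (lookup (d i x) y) 0 = 0"
  using assms unfolding minimal_graded_free_resolution_def by (simp_all del: split_paired_All)

lemma image_d_constant_coeff:
  assumes res: "minimal_graded_free_resolution n J b e d" and w: "w \<in> free_module n (b (Suc i))"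
  shows "lookup (lookup (lin_fvec (d i) w) x) 0 = 0"
  unfolding lin_fvec_def lookup_sum
proof (rule sum.neutral, rule ballI)
  fix z assume "z \<in> keys w"
  then show "lookup (lookup (fvec_scale (lookup w z) (d i z)) x) 0 = 0"
    using resolution_minimal[OF res keys_subset_basis[OF w]] by (simp add: const_coeff_mult)
qed

text \<open>
  Suppose that \<open>F\<^sub>1\<close> has a basis element \<open>x\<close> of degree \<open>p\<close>. Its image is a decomposable syzygy, hence
  also the image of some \<open>y\<close> whose coefficient at \<open>x\<close> has no constant term, because \<open>y\<close> is
  a combination of multiples of homogeneous elements of degree below \<open>p\<close>. Then \<open>x - y\<close> is a second syzygy with constant term \<open>1\<close> at \<open>x\<close>,
  which contradicts minimality of the next differential.
\<close>
lemma betti_1_zero_if_syzygies_decomposable: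
  assumes res: "minimal_graded_free_resolution n J b e d"
    and Z: "Z = {v \<in> free_module n (b 0). lin_poly e v = 0}"
    and dec: "Z \<inter> {v. fvec_homogeneous p v} \<subseteq> decomposables n Z p"
  shows "b 1 p = 0"
proof (rule ccontr)
  assume "b 1 p \<noteq> 0"
  define x where "x = (p, 0 :: nat)"
  have x: "x \<in> basis (b 1)" using \<open>b 1 p \<noteq> 0\<close> by (simp add: x_def basis_def)
  have hom_d: "fvec_homogeneous (fst y) (d 0 y)" if "y \<in> basis (b 1)" for y
    using resolution_d_hom[OF res, of y 0] that by simp
  have im_d0: "lin_fvec (d 0) ` free_module n (b 1) = Z"
    unfolding Z by (rule resolution_image_d0[OF res])
  define L where "L = lin_fvec (d 0) ` {y \<in> free_module n (b 1). lookup (lookup y x) 0 = 0}"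
  have "K.subspace L"
    unfolding L_def
  proof (intro K.subspaceI)
    let ?A = "{y \<in> free_module n (b 1). lookup (lookup y x) 0 = 0}"
    show "0 \<in> lin_fvec (d 0) ` ?A" by (rule image_eqI[of _ _ 0]) auto
    fix u v assume "u \<in> lin_fvec (d 0) ` ?A" "v \<in> lin_fvec (d 0) ` ?A"
    then show "u + v \<in> lin_fvec (d 0) ` ?A"
      by (auto simp: lookup_add simp flip: lin_fvec_add intro!: imageI)
  next
    let ?A = "{y \<in> free_module n (b 1). lookup (lookup y x) 0 = 0}"
    fix c u assume "u \<in> lin_fvec (d 0) ` ?A"
    then show "kscale c u \<in> lin_fvec (d 0) ` ?A"
      by (auto simp: kscale_def const_coeff_mult simp flip: lin_fvec_scale intro!: imageI)
  qed
  then have "decomposables n Z p \<subseteq> L"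
    unfolding decomposables_def
  proof (rule K.span_minimal[rotated], safe)
    fix r :: "'a mpoly" and u q
    assume *: "q < p" "r \<in> mpolys n" "u \<in> Z" "fvec_homogeneous q u"
    then obtain y where y: "y \<in> free_module n (b 1)" "u = lin_fvec (d 0) y" using im_d0 by blast
    have "lin_fvec (d 0) (hcomp q y) = u"
      using hcomp_lin_fvec[OF hom_d y(1), of q] *(4) y(2) by (simp add: hcomp_homogeneous)
    moreover have "lookup (lookup (hcomp q y) x) 0 = 0"
      using *(1) by (simp add: lookup_hcomp x_def)
    ultimately show "fvec_scale r u \<in> L"
      using *(2) y(1) unfolding L_def
      by (intro image_eqI[of _ _ "fvec_scale r (hcomp q y)"])
        (auto simp: lin_fvec_scale const_coeff_mult)
  qed
  moreover have "d 0 x \<in> Z"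
    using x im_d0 by (force intro: image_eqI[of _ _ "single x 1"])
  ultimately have "d 0 x \<in> L" using dec hom_d[OF x] by (auto simp: x_def)
  then obtain y where y: "y \<in> free_module n (b 1)" "lookup (lookup y x) 0 = 0"
      "lin_fvec (d 0) y = d 0 x"
    unfolding L_def by force
  have "single x 1 - y \<in> free_module n (b 1)"
    using x y(1) by (intro K.subspace_diff[OF K_subspace_free_module]) simp_all
  moreover have "lin_fvec (d 0) (single x 1 - y) = 0"
    using y(3) by (simp add: lin_fvec_minus)
  ultimately have "single x 1 - y \<in> lin_fvec (d (Suc 0)) ` free_module n (b (Suc (Suc 0)))"
    unfolding resolution_image_d[OF res] by simp
  then have "lookup (lookup (single x 1 - y) x) 0 = 0"
    using image_d_constant_coeff[OF res] by fastforce
  moreover have "lookup (lookup (single x 1 - y) x) 0 = 1"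
    using y(2) by (simp add: lookup_minus)
  ultimately show False by simp
qed

section \<open>A connectivity criterion for monomial ideals\<close>

definition mono_ideal :: "nat \<Rightarrow> monomial set \<Rightarrow> 'a::field mpoly set" where
  "mono_ideal n S = {f \<in> mpolys n. \<forall>u \<in> keys f. \<exists>s \<in> S. mdivides s u}"

text \<open>
  If the generators \<open>s\<close>, \<open>s'\<close> divide \<open>u\<close>, the condition says that their least common multiple is not
  \<open>u\<close>. Allowing any common multiple \<open>l\<close> avoids least common multiples of exponent vectors.
\<close>
definition linked :: "monomial set \<Rightarrow> monomial \<Rightarrow> monomial \<Rightarrow> monomial \<Rightarrow> bool" where
  "linked S u s s' \<longleftrightarrow> s \<in> S \<and> s' \<in> S \<and>
     (\<exists>l. mdivides s l \<and> mdivides s' l \<and> mdivides l u \<and> l \<noteq> u)"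

lemma mdivides_add_diff: "mdivides s u \<Longrightarrow> (u - s) + s = u"
  by (rule poly_mapping_eqI) (simp add: mdivides_def lookup_add lookup_minus)

lemma mdivides_add_left [simp]: "mdivides s u \<Longrightarrow> mdivides s (m + u)"
  by (simp add: mdivides_def lookup_add trans_le_add2)

lemma keys_diff_subset: "keys (u - s) \<subseteq> keys u" for u s :: monomial
  by (auto simp: in_keys_iff lookup_minus)

lemma mdegree_diff: "mdivides s u \<Longrightarrow> mdegree u = mdegree (u - s) + mdegree s"
  by (metis mdegree_add mdivides_add_diff)

lemma mdivides_less_degree: "mdivides l u \<Longrightarrow> l \<noteq> u \<Longrightarrow> mdegree l < mdegree u"
  by (metis add.commute add_0 gr_zeroI less_add_same_cancel2 mdegree_diff mdegree_eq_0_iff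
      mdivides_add_diff)

lemma mdivides_trans: "mdivides a b \<Longrightarrow> mdivides b c \<Longrightarrow> mdivides a c"
  unfolding mdivides_def using le_trans by blast

lemma graded_first_syzygies:
  assumes "minimal_graded_free_resolution n J b e d"
  shows "graded_submodule n (b 0) {v \<in> free_module n (b 0). lin_poly e v = 0}"
proof -
  have "lin_poly e v = 0 \<longleftrightarrow> lin_fvec (\<lambda>x. embed (e x)) v = 0" for v
    by (simp flip: lin_poly_eq_lin_fvec)
  then show ?thesis
    using resolution_e_hom[OF assms] graded_submodule_kernel[of "b 0" "\<lambda>x. embed (e x)" n]
    by simp
qed

text \<open>
  The generators in \<open>F\<^sub>0\<close> are those of an arbitrary minimal resolution, not the monomials in
  \<open>S\<close>, so the monomial syzygies have to be transported to \<open>F\<^sub>0\<close>. Choose homogeneous lifts \<open>W s\<close> of the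
  monomials \<open>s\<close> and let \<open>\<tau> u s\<close> be the resulting lift \<open>(u/s) W s\<close> of \<open>u\<close>. Connectivity says that
  for \<open>u\<close> of degree \<open>p\<close> this lift does not depend on \<open>s\<close> modulo decomposable syzygies. Choosing one \<open>s\<close>
  for every \<open>u\<close> gives a linear section \<open>lift\<close> of the augmentation, which modulo decomposables
  commutes with multiplication into degree \<open>p\<close>. For a syzygy \<open>v = \<Sum> v\<^sub>x x\<close> of degree \<open>p\<close> this yields
  \<open>v \<equiv> \<Sum> v\<^sub>x lift(e x) \<equiv> lift(\<Sum> v\<^sub>x e x) = lift(0) = 0\<close>.
\<close>
lemma monomial_ideal_betti_1_zero:
  fixes b :: "nat \<Rightarrow> nat \<Rightarrow> nat" and e :: "nat \<times> nat \<Rightarrow> 'a::field mpoly"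
  assumes S: "\<And>s. s \<in> S \<Longrightarrow> keys s \<subseteq> {1..n}"
    and conn: "\<And>u s s'. mdegree u = p \<Longrightarrow> s \<in> S \<Longrightarrow> s' \<in> S \<Longrightarrow>
      mdivides s u \<Longrightarrow> mdivides s' u \<Longrightarrow> (linked S u)\<^sup>*\<^sup>* s s'"
    and res: "minimal_graded_free_resolution n (mono_ideal n S) b e d"
  shows "b 1 p = 0"
proof -
  let ?J = "mono_ideal n S :: 'a mpoly set"
  define Z where "Z = {v \<in> free_module n (b 0). lin_poly e v = 0}"
  define N where "N = decomposables n Z p"
  have N: "K.subspace N" by (simp add: N_def decomposables_def)
  have gZ: "graded_submodule n (b 0) Z"
    using graded_first_syzygies[OF res] by (simp add: Z_def)
  have im_e: "lin_poly e ` free_module n (b 0) = ?J"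
    by (rule resolution_image_e[OF res])
  note hom_e = resolution_e_hom[OF res]
  have e_mem: "e x \<in> ?J" if "x \<in> basis (b 0)" for x
    using im_e that imageI[of "single x 1" "free_module n (b 0)" "lin_poly e"]
    by (simp add: lin_poly_single)
  have gen_N: "fvec_scale r u \<in> N"
    if "q < p" "r \<in> mpolys n" "homogeneous (p - q) r" "u \<in> Z" "fvec_homogeneous q u" for r u q
    using that unfolding N_def decomposables_def by (intro K.span_base) blast
  have "\<exists>w. w \<in> free_module n (b 0) \<and> fvec_homogeneous (mdegree s) w \<and> lin_poly e w = monom s"
    if "s \<in> S" for s
  proof -
    have "monom s \<in> ?J"
      using S[OF that] that by (auto simp: mono_ideal_def monom_def mdivides_def)
    then obtain v where v: "v \<in> free_module n (b 0)" "monom s = lin_poly e v"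
      using im_e by blast
    have "embed (lin_poly e (hcomp (mdegree s) v)) = hcomp (mdegree s) (embed (monom s))"
      unfolding v(2) lin_poly_eq_lin_fvec
      using hcomp_lin_fvec[of "b 0" "\<lambda>x. embed (e x)" v n "mdegree s"] v(1) hom_e by simp
    also have "\<dots> = embed (monom s)"
      by (subst hcomp_homogeneous[of "mdegree s"]) (simp_all add: monom_def)
    finally show ?thesis using v(1) by (intro exI[of _ "hcomp (mdegree s) v"]) simp
  qed
  then obtain W where W: "\<And>s. s \<in> S \<Longrightarrow> W s \<in> free_module n (b 0)"
      "\<And>s. s \<in> S \<Longrightarrow> fvec_homogeneous (mdegree s) (W s)"
      "\<And>s. s \<in> S \<Longrightarrow> lin_poly e (W s) = monom s"
    by metis
  define \<tau> where "\<tau> u s = fvec_scale (monom (u - s)) (W s)" for u s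
  have \<tau>: "\<tau> u s \<in> free_module n (b 0)" "fvec_homogeneous (mdegree u) (\<tau> u s)"
      "lin_poly e (\<tau> u s) = monom u"
    if "keys u \<subseteq> {1..n}" "s \<in> S" "mdivides s u" for u s
  proof -
    have "keys (u - s) \<subseteq> {1..n}" using keys_diff_subset that(1) by blast
    then show "\<tau> u s \<in> free_module n (b 0)" by (simp add: \<tau>_def W that monom_def)
    show "fvec_homogeneous (mdegree u) (\<tau> u s)"
      using fvec_homogeneous_scale[OF _ W(2)[OF that(2)], of "mdegree (u - s)" "monom (u - s)"]
        mdegree_diff[OF that(3)] by (simp add: \<tau>_def monom_def)
    show "lin_poly e (\<tau> u s) = monom u"
      using mdivides_add_diff[OF that(3)]
      by (simp add: \<tau>_def lin_poly_scale W that monom_def mult_single)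
  qed
  have link: "\<tau> u s - \<tau> u s' \<in> N"
    if u: "keys u \<subseteq> {1..n}" "mdegree u = p" and l: "linked S u s s'" for u s s'
  proof -
    from l obtain l where s: "s \<in> S" "s' \<in> S" and l: "mdivides s l" "mdivides s' l"
        "mdivides l u" "l \<noteq> u"
      unfolding linked_def by blast
    have keys_l: "keys l \<subseteq> {1..n}"
      using u(1) mdivides_add_diff[OF l(3)] by (metis keys_add_nat le_sup_iff)
    have "(u - l) + (l - r) = u - r" if "mdivides r l" for r
      using that l(3) by (intro poly_mapping_eqI) (simp add: mdivides_def lookup_add lookup_minus)
    \<comment> \<open>Both lifts of \<open>u\<close> are the same multiple of lifts of the proper divisor \<open>l\<close>.\<close>
    then have "\<tau> u r = fvec_scale (monom (u - l)) (\<tau> l r)" if "mdivides r l" for r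
      using that by (simp add: \<tau>_def monom_def mult_single)
    then have "\<tau> u s - \<tau> u s' = fvec_scale (monom (u - l)) (\<tau> l s - \<tau> l s')"
      using l by (simp add: R.scale_right_diff_distrib)
    also have "\<dots> \<in> N"
    proof (rule gen_N)
      show "mdegree l < p" using mdivides_less_degree[OF l(3,4)] u(2) by simp
      show "monom (u - l) \<in> mpolys n"
        using keys_diff_subset[of u l] u(1) by (auto simp: monom_def)
      show "homogeneous (p - mdegree l) (monom (u - l) :: 'a mpoly)"
        using mdegree_diff[OF l(3)] u(2) by (simp add: monom_def)
      show "\<tau> l s - \<tau> l s' \<in> Z"
        using \<tau>[OF keys_l s(1) l(1)] \<tau>[OF keys_l s(2) l(2)]
          K.subspace_diff[OF K_subspace_free_module] by (simp add: Z_def lin_poly_diff)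
      show "fvec_homogeneous (mdegree l) (\<tau> l s - \<tau> l s')"
        using \<tau>[OF keys_l s(1) l(1)] \<tau>[OF keys_l s(2) l(2)]
          K.subspace_diff[OF K_subspace_homogeneous] by simp
    qed
    finally show ?thesis .
  qed
  have indep: "\<tau> u s - \<tau> u s' \<in> N"
    if u: "keys u \<subseteq> {1..n}" "mdegree u = p"
      and s: "s \<in> S" "s' \<in> S" "mdivides s u" "mdivides s' u" for u s s'
    using conn[OF u(2) s]
  proof (induction rule: rtranclp_induct)
    case base then show ?case using K.subspace_0[OF N] by simp
  next
    case (step r r')
    then show ?case using K.subspace_add[OF N _ link[OF u step(2)]] by fastforce
  qed
  define sel where "sel u = (SOME s. s \<in> S \<and> mdivides s u)" for u
  have sel: "sel u \<in> S" "mdivides (sel u) u" if "u \<in> keys f" "f \<in> ?J" for u f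
  proof -
    have "\<exists>s. s \<in> S \<and> mdivides s u" using that by (auto simp: mono_ideal_def)
    then show "sel u \<in> S" "mdivides (sel u) u"
      unfolding sel_def by (metis (mono_tags, lifting) someI_ex)+
  qed
  define \<sigma> where "\<sigma> u = \<tau> u (sel u)" for u
  define lift where "lift f = (\<Sum>u\<in>keys f. kscale (lookup f u) (\<sigma> u))" for f
  have keys_J: "keys u \<subseteq> {1..n}" if "u \<in> keys f" "f \<in> ?J" for u f
    using that by (auto simp: mono_ideal_def mpolys_def)
  have lift_superset: "lift f = (\<Sum>u\<in>U. kscale (lookup f u) (\<sigma> u))" if "finite U" "keys f \<subseteq> U" for f U
    unfolding lift_def using that by (intro sum.mono_neutral_left) (auto simp: in_keys_iff)
  have lift_add: "lift (f + g) = lift f + lift g" for f g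
    using keys_add[of f g]
    by (simp add: lift_superset[of "keys f \<union> keys g"] lookup_add K.scale_left_distrib sum.distrib)
  have lift_sum: "lift (sum F A) = (\<Sum>i\<in>A. lift (F i))" for F :: "'c \<Rightarrow> 'a mpoly" and A
    by (induction A rule: infinite_finite_induct) (simp_all add: lift_add, simp_all add: lift_def)
  have lift_single: "lift (single u c) = kscale c (\<sigma> u)" for u c
    by (simp add: lift_def)
  have lift_lift: "lift f \<in> free_module n (b 0)" "lin_poly e (lift f) = f"
    if f: "f \<in> ?J" for f
  proof -
    have \<sigma>: "\<sigma> u \<in> free_module n (b 0)" "lin_poly e (\<sigma> u) = monom u" if "u \<in> keys f" for u
      unfolding \<sigma>_def using \<tau>[OF keys_J sel] that f by blast+
    show "lift f \<in> free_module n (b 0)"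
      unfolding lift_def using \<sigma> by (intro K.subspace_sum[OF K_subspace_free_module]) simp
    have "lin_poly e (lift f) = (\<Sum>u\<in>keys f. single u (lookup f u))"
      unfolding lift_def lin_poly_sum
      using \<sigma> by (intro sum.cong) (simp_all add: kscale_def lin_poly_scale monom_def mult_single)
    then show "lin_poly e (lift f) = f" using mpoly_expand[of f] by simp
  qed
  have lift_hom: "fvec_homogeneous q (lift f)" if f: "f \<in> ?J" "homogeneous q f" for f q
    unfolding lift_def
  proof (rule K.subspace_sum[OF K_subspace_homogeneous, unfolded mem_Collect_eq])
    fix u assume u: "u \<in> keys f"
    then have "mdegree u = q" using f(2) by (simp add: homogeneous_def)
    then show "fvec_homogeneous q (kscale (lookup f u) (\<sigma> u))"
      unfolding \<sigma>_def using \<tau>(2)[OF keys_J sel] u f by fastforce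
  qed
  have lift_mult: "fvec_scale r (lift f) - lift (r * f) \<in> N"
    if f: "f \<in> ?J" "homogeneous q f" and r: "r \<in> mpolys n" "homogeneous a r" and p: "a + q = p"
    for r f a q
  proof -
    have "r * f = (\<Sum>m\<in>keys r. single m (lookup r m)) * (\<Sum>u\<in>keys f. single u (lookup f u))"
      by (simp flip: mpoly_expand)
    also have "\<dots> = (\<Sum>m\<in>keys r. \<Sum>u\<in>keys f. single (m + u) (lookup r m * lookup f u))"
      by (simp add: sum_product mult_single)
    finally have 1: "lift (r * f) = (\<Sum>m\<in>keys r. \<Sum>u\<in>keys f. kscale (lookup r m * lookup f u) (\<sigma> (m + u)))"
      by (simp add: lift_sum lift_single)
    have "fvec_scale r (lift f) = fvec_scale (\<Sum>m\<in>keys r. single m (lookup r m)) (lift f)"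
      by (simp flip: mpoly_expand)
    also have "\<dots> = (\<Sum>m\<in>keys r. \<Sum>u\<in>keys f. kscale (lookup r m * lookup f u) (fvec_scale (monom m) (\<sigma> u)))"
      unfolding R.scale_sum_left lift_def R.scale_sum_right
      by (subst sum.swap, intro sum.cong refl)
        (simp add: kscale_def monom_def mult_single)
    finally have "fvec_scale r (lift f) - lift (r * f) = (\<Sum>m\<in>keys r. \<Sum>u\<in>keys f.
        kscale (lookup r m * lookup f u) (fvec_scale (monom m) (\<sigma> u) - \<sigma> (m + u)))"
      unfolding 1 by (simp add: sum_subtractf K.scale_right_diff_distrib)
    also have "\<dots> \<in> N"
    proof (intro K.subspace_sum[OF N] K.subspace_scale[OF N])
      fix m u assume m: "m \<in> keys r" and u: "u \<in> keys f"
      have div: "mdivides (sel u) (m + u)" using sel(2)[OF u f(1)] by simp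
      have "\<exists>s. s \<in> S \<and> mdivides s (m + u)" using div sel(1)[OF u f(1)] by blast
      then have s': "sel (m + u) \<in> S" "mdivides (sel (m + u)) (m + u)"
        unfolding sel_def by (metis (mono_tags, lifting) someI_ex)+
      have "m + (u - sel u) = m + u - sel u"
        using sel(2)[OF u f(1)]
        by (intro poly_mapping_eqI) (simp add: mdivides_def lookup_add lookup_minus)
      then have "fvec_scale (monom m) (\<sigma> u) = \<tau> (m + u) (sel u)"
        by (simp add: \<sigma>_def \<tau>_def monom_def mult_single)
      moreover have "keys (m + u) \<subseteq> {1..n}"
        using m r(1) keys_J[OF u f(1)] by (auto simp: keys_add_nat mpolys_def)
      moreover have "mdegree (m + u) = p"
        using m u r(2) f(2) p by (simp add: mdegree_add homogeneous_def)
      ultimately show "fvec_scale (monom m) (\<sigma> u) - \<sigma> (m + u) \<in> N"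
        using indep[OF _ _ sel(1)[OF u f(1)] s'(1) div s'(2)] by (simp add: \<sigma>_def)
    qed
    finally show ?thesis .
  qed
  have min: "lookup (lookup v x) 0 = 0" if "v \<in> Z" for v x
  proof -
    have "v \<in> lin_fvec (d 0) ` free_module n (b (Suc 0))"
      using that resolution_image_d0[OF res] by (simp add: Z_def)
    then show ?thesis using image_d_constant_coeff[OF res, of _ 0 x] by blast
  qed
  have "Z \<inter> {v. fvec_homogeneous p v} \<subseteq> N"
  proof
    fix v assume v: "v \<in> Z \<inter> {v. fvec_homogeneous p v}"
    then have vF: "v \<in> free_module n (b 0)" "lin_poly e v = 0" by (auto simp: Z_def)
    have "fvec_scale (lookup v x) (single x 1) - lift (lookup v x * e x) \<in> N" if x: "x \<in> keys v" for x
    proof -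
      have xb: "x \<in> basis (b 0)" and vx: "lookup v x \<in> mpolys n"
        using vF x by (auto simp: free_module_def)
      have "lookup v x \<noteq> 0" using x by (simp add: in_keys_iff)
      then have hom: "fst x \<le> p" "homogeneous (p - fst x) (lookup v x)"
        using v unfolding fvec_homogeneous_coeffwise by blast+
      \<comment> \<open>Here minimality enters: a syzygy has no constant coefficients, so \<open>v\<^sub>x\<close> has positive degree
        and \<open>v\<^sub>x (x - lift(e x))\<close> is decomposable.\<close>
      have "fst x \<noteq> p"
      proof
        assume "fst x = p"
        then have "lookup v x = single 0 (lookup (lookup v x) 0)"
          using hom(2) by (intro homogeneous_degree_0) simp
        with min[of v x] v \<open>lookup v x \<noteq> 0\<close> show False by simp
      qed
      with hom have "fst x < p" by simp
      have "fvec_scale (lookup v x) (single x 1 - lift (e x)) \<in> N"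
      proof (rule gen_N[OF \<open>fst x < p\<close> vx hom(2)])
        show "single x 1 - lift (e x) \<in> Z"
          using lift_lift[OF e_mem[OF xb]]
            K.subspace_diff[OF K_subspace_free_module free_module_single[OF mpolys_1 xb]]
          by (simp add: Z_def lin_poly_diff lin_poly_single)
        have "fvec_homogeneous (fst x) (single x 1)"
          by (auto simp: fvec_homogeneous_def)
        then show "fvec_homogeneous (fst x) (single x 1 - lift (e x))"
          using lift_hom[OF e_mem[OF xb] hom_e[OF xb]] K.subspace_diff[OF K_subspace_homogeneous]
          by simp
      qed
      moreover have "fvec_scale (lookup v x) (lift (e x)) - lift (lookup v x * e x) \<in> N"
        using lift_mult[OF e_mem[OF xb] hom_e[OF xb] vx hom(2)] hom(1) by simp
      ultimately show ?thesis
        using K.subspace_add[OF N] by (fastforce simp: R.scale_right_diff_distrib)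
    qed
    then have "(\<Sum>x\<in>keys v. fvec_scale (lookup v x) (single x 1) - lift (lookup v x * e x)) \<in> N"
      by (rule K.subspace_sum[OF N])
    also have "(\<Sum>x\<in>keys v. fvec_scale (lookup v x) (single x 1) - lift (lookup v x * e x))
        = lin_fvec (\<lambda>x. single x 1) v - lift (lin_poly e v)"
      by (simp add: sum_subtractf lin_fvec_def lin_poly_def lift_sum)
    also have "\<dots> = v" using vF(2) by (simp add: lift_def flip: fvec_eq_lin)
    finally show "v \<in> N" .
  qed
  then show ?thesis
    by (intro betti_1_zero_if_syzygies_decomposable[OF res Z_def]) (simp add: N_def)
qed

section \<open>Monomial ideals\<close>

lemma ideal_gen_subset_mono_ideal:
  fixes X :: "'a::field mpoly set"
  assumes "X \<subseteq> mono_ideal n P"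
  shows "ideal_gen n X \<subseteq> mono_ideal n P"
proof
  fix f :: "'a mpoly" assume "f \<in> ideal_gen n X"
  then obtain T c where T: "finite T" "T \<subseteq> X" "\<forall>g\<in>T. c g \<in> mpolys n" and f: "f = (\<Sum>g\<in>T. c g * g)"
    unfolding ideal_gen_def by blast
  have add: "g + h \<in> mono_ideal n P" if "g \<in> mono_ideal n P" "h \<in> mono_ideal n P" for g h :: "'a mpoly"
    using that keys_add[of g h] by (auto simp: mono_ideal_def)
  have zero: "0 \<in> (mono_ideal n P :: 'a mpoly set)" by (simp add: mono_ideal_def)
  have "c g * g \<in> mono_ideal n P" if "g \<in> T" for g
  proof -
    have "c g \<in> mpolys n" "g \<in> mono_ideal n P" using T that assms by auto
    moreover have "\<exists>s\<in>P. mdivides s u" if u: "u \<in> keys (c g * g)" for u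
    proof -
      obtain v w where "u = v + w" "w \<in> keys g" using u keys_mult[of "c g" g] by auto
      with \<open>g \<in> mono_ideal n P\<close> show ?thesis
        unfolding mono_ideal_def using mdivides_add_left by blast
    qed
    ultimately show ?thesis by (simp add: mono_ideal_def)
  qed
  with T(1) have "(\<Sum>g\<in>T. c g * g) \<in> mono_ideal n P"
    by (induction T rule: finite_induct) (simp_all add: add zero)
  then show "f \<in> mono_ideal n P" using f by blast
qed

lemma mono_ideal_subset_ideal_gen:
  fixes X :: "'a::field mpoly set"
  assumes "\<And>s. s \<in> P \<Longrightarrow> monom s \<in> X"
  shows "mono_ideal n P \<subseteq> ideal_gen n X"
proof
  fix f :: "'a mpoly" assume f: "f \<in> mono_ideal n P"
  then have "\<forall>u\<in>keys f. \<exists>s\<in>P. mdivides s u" by (simp add: mono_ideal_def)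
  then obtain s where s: "\<And>u. u \<in> keys f \<Longrightarrow> s u \<in> P" "\<And>u. u \<in> keys f \<Longrightarrow> mdivides (s u) u"
    by metis
  define h :: "monomial \<Rightarrow> 'a mpoly" where "h u = monom (s u)" for u
  define c where "c g = (\<Sum>u\<in>{u \<in> keys f. h u = g}. single (u - s u) (lookup f u))" for g
  have "f = (\<Sum>u\<in>keys f. single (u - s u) (lookup f u) * h u)"
    by (subst mpoly_expand) (simp add: h_def monom_def mult_single mdivides_add_diff s)
  also have "\<dots> = (\<Sum>g\<in>h ` keys f. \<Sum>u\<in>{u \<in> keys f. h u = g}. single (u - s u) (lookup f u) * h u)"
    by (rule sum.image_gen) simp
  also have "\<dots> = (\<Sum>g\<in>h ` keys f. c g * g)"
    unfolding c_def sum_distrib_right by (intro sum.cong) auto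
  finally have "f = (\<Sum>g\<in>h ` keys f. c g * g)" .
  moreover have "h ` keys f \<subseteq> X" using s assms by (auto simp: h_def)
  moreover have "c g \<in> mpolys n" for g
    unfolding c_def
  proof (rule mpolys_sum)
    fix u assume "u \<in> {u \<in> keys f. h u = g}"
    then have "keys u \<subseteq> {1..n}" using f by (auto simp: mono_ideal_def mpolys_def)
    then show "single (u - s u) (lookup f u) \<in> mpolys n"
      using keys_diff_subset[of u "s u"] unfolding mpolys_single by blast
  qed
  ultimately show "f \<in> ideal_gen n X"
    unfolding ideal_gen_def by (auto intro!: exI[of _ "h ` keys f"] exI[of _ c])
qed

lemma monom_in_mono_ideal:
  "monom m \<in> (mono_ideal n P :: 'a::field mpoly set) \<longleftrightarrow>
     keys m \<subseteq> {1..n} \<and> (\<exists>s\<in>P. mdivides s m)"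
  by (simp add: mono_ideal_def monom_def)

lemma ideal_gen_monom:
  assumes "\<And>s. s \<in> P \<Longrightarrow> keys s \<subseteq> {1..n}"
  shows "ideal_gen n (monom ` P) = (mono_ideal n P :: 'a::field mpoly set)"
proof (rule antisym)
  show "ideal_gen n (monom ` P) \<subseteq> (mono_ideal n P :: 'a mpoly set)"
    using assms
    by (intro ideal_gen_subset_mono_ideal) (force simp: monom_in_mono_ideal mdivides_def)
qed (rule mono_ideal_subset_ideal_gen, simp)

text \<open>
  For \<open>k = 0\<close> the only sum is the empty one, and the monomial \<open>1\<close> generates the whole ring.
\<close>
lemma ideal_power_mono_ideal:
  assumes "\<And>s. s \<in> P \<Longrightarrow> keys s \<subseteq> {1..n}"
  shows "ideal_power n (mono_ideal n P) k =
    (mono_ideal n {\<Sum>i<k. g i | g. \<forall>i<k. g i \<in> P} :: 'a::field mpoly set)"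
proof (induction k)
  case 0
  show ?case by (auto simp: mono_ideal_def mdivides_def)
next
  case (Suc k)
  let ?P = "\<lambda>k::nat. {\<Sum>i<k. g i | g. \<forall>i<k. g i \<in> P}"
  let ?X = "{f * g | f g. f \<in> mono_ideal n P \<and> g \<in> (mono_ideal n (?P k) :: 'a mpoly set)}"
  have keys_sum: "keys (\<Sum>i<j. g i) \<subseteq> {1..n}" if "\<forall>i<j. g i \<in> P" for g and j :: nat
    using that
  proof (induction j)
    case (Suc j)
    then show ?case using assms[of "g j"] by (simp add: keys_add_nat)
  qed simp
  have keys_P: "keys s \<subseteq> {1..n}" if "s \<in> ?P j" for s and j :: nat
  proof -
    from that obtain g where "s = (\<Sum>i<j. g i)" "\<forall>i<j. g i \<in> P" by blast
    then show ?thesis using keys_sum[of j g] by simp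
  qed
  have "?X \<subseteq> mono_ideal n (?P (Suc k))"
  proof
    fix h assume "h \<in> ?X"
    then obtain f g where h: "h = f * g" and f: "f \<in> mono_ideal n P" and g: "g \<in> mono_ideal n (?P k)"
      by blast
    have "\<exists>s\<in>?P (Suc k). mdivides s u" if "u \<in> keys h" for u
    proof -
      from that obtain v w where u: "u = v + w" "v \<in> keys f" "w \<in> keys g"
        using keys_mult[of f g] h by auto
      obtain s where s: "s \<in> P" "mdivides s v" using f u by (auto simp: mono_ideal_def)
      obtain a where a: "\<forall>i<k. a i \<in> P" "mdivides (\<Sum>i<k. a i) w"
        using g u by (auto simp: mono_ideal_def)
      have "(\<Sum>i<k. a i) + s \<in> ?P (Suc k)"
        using a(1) s(1) by (intro CollectI exI[of _ "a(k := s)"]) (simp add: less_Suc_eq)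
      moreover have "mdivides ((\<Sum>i<k. a i) + s) u"
        using s(2) a(2) unfolding mdivides_def u lookup_add by (simp add: add.commute add_mono)
      ultimately show ?thesis by blast
    qed
    then show "h \<in> mono_ideal n (?P (Suc k))"
      using f g by (simp add: h mono_ideal_def)
  qed
  then have "ideal_gen n ?X \<subseteq> mono_ideal n (?P (Suc k))"
    by (rule ideal_gen_subset_mono_ideal)
  moreover have "mono_ideal n (?P (Suc k)) \<subseteq> ideal_gen n ?X"
  proof (rule mono_ideal_subset_ideal_gen)
    fix s assume "s \<in> ?P (Suc k)"
    then obtain a where a: "s = (\<Sum>i<Suc k. a i)" "\<forall>i<Suc k. a i \<in> P" by blast
    have "monom s = monom (a k) * (monom (\<Sum>i<k. a i) :: 'a mpoly)"
      by (simp add: a monom_def mult_single add.commute)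
    moreover have "monom (a k) \<in> (mono_ideal n P :: 'a mpoly set)"
      using assms a(2) by (auto simp: monom_in_mono_ideal mdivides_def)
    moreover have mem: "(\<Sum>i<k. a i) \<in> ?P k" using a(2) by auto
    then have "monom (\<Sum>i<k. a i) \<in> (mono_ideal n (?P k) :: 'a mpoly set)"
      unfolding monom_in_mono_ideal
      using keys_P[OF mem] by (blast intro: mdivides_def[THEN iffD2])
    ultimately show "monom s \<in> ?X" by blast
  qed
  ultimately show ?case by (simp add: Suc.IH)
qed

text \<open>
  Distinct monomials of equal degree do not divide each other, so none of the generators is redundant.
\<close>
lemma min_monomial_gens_mono_ideal:
  assumes P: "\<And>s. s \<in> P \<Longrightarrow> keys s \<subseteq> {1..n}" "\<And>s. s \<in> P \<Longrightarrow> mdegree s = D"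
  shows "min_monomial_gens (mono_ideal n P :: 'a::field mpoly set) = P"
proof (intro set_eqI iffI)
  fix m assume "m \<in> min_monomial_gens (mono_ideal n P :: 'a mpoly set)"
  then obtain s where "s \<in> P" "mdivides s m"
      "\<And>m'. keys m' \<subseteq> {1..n} \<Longrightarrow> \<exists>s\<in>P. mdivides s m' \<Longrightarrow> mdivides m' m \<Longrightarrow> m' = m"
    by (auto simp: min_monomial_gens_def monom_in_mono_ideal)
  moreover have "mdivides s s" by (simp add: mdivides_def)
  ultimately show "m \<in> P" using P(1) by blast
next
  fix m assume m: "m \<in> P"
  have "m' = m" if "s \<in> P" "mdivides s m'" "mdivides m' m" for s m'
  proof -
    have "s = m" using mdivides_less_degree[OF mdivides_trans[OF that(2,3)]] P(2) that(1) m by force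
    with that show "m' = m"
      by (intro poly_mapping_eqI) (simp add: mdivides_def antisym)
  qed
  then show "m \<in> min_monomial_gens (mono_ideal n P :: 'a mpoly set)"
    using m P(1) by (auto simp: min_monomial_gens_def monom_in_mono_ideal mdivides_def)
qed

lemma graded_mono_ideal:
  "graded_submodule n (\<lambda>q. if q = 0 then 1 else 0) (embed ` (mono_ideal n P :: 'a::field mpoly set))"
proof -
  let ?\<delta> = "\<lambda>q::nat. if q = 0 then 1 else 0 :: nat"
  let ?I = "mono_ideal n P :: 'a mpoly set"
  have char: "v \<in> embed ` ?I \<longleftrightarrow> v \<in> free_module n ?\<delta> \<and> (\<forall>x. \<forall>u\<in>keys (lookup v x). \<exists>s\<in>P. mdivides s u)"
    (is "_ \<longleftrightarrow> ?R v") for v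
  proof
    assume "v \<in> embed ` ?I"
    then show "?R v"
      by (auto simp: mono_ideal_def lookup_single when_def basis_def intro!: free_module_single
          split: if_splits)
  next
    assume R: "?R v"
    have "lookup v x = 0" if "x \<noteq> (0, 0)" for x
      using R that unfolding free_module_iff by (cases x) (auto simp: basis_def split: if_splits)
    then have "v = embed (lookup v (0, 0))"
      by (intro poly_mapping_eqI) (auto simp: lookup_single when_def)
    moreover have "lookup v (0, 0) \<in> ?I"
      using R unfolding mono_ideal_def free_module_iff by blast
    ultimately show "v \<in> embed ` ?I" by blast
  qed
  show ?thesis
    unfolding graded_submodule_def
  proof (intro conjI ballI allI subsetI)
    show "0 \<in> embed ` ?I" by (simp add: char)
  next
    fix v assume "v \<in> embed ` ?I"
    then show "v \<in> free_module n ?\<delta>" by (simp add: char)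
  next
    fix u v assume uv: "u \<in> embed ` ?I" "v \<in> embed ` ?I"
    have "keys (lookup (u + v) x) \<subseteq> keys (lookup u x) \<union> keys (lookup v x)" for x
      by (simp add: lookup_add keys_add)
    with uv show "u + v \<in> embed ` ?I" unfolding char by (meson UnE free_module_add subsetD)
  next
    fix r :: "'a mpoly" and v assume r: "r \<in> mpolys n" and v: "v \<in> embed ` ?I"
    have "\<exists>s\<in>P. mdivides s u" if "u \<in> keys (lookup (fvec_scale r v) x)" for u x
    proof -
      from that obtain m w where "u = m + w" "w \<in> keys (lookup v x)"
        using keys_mult[of r "lookup v x"] by auto
      with v show ?thesis unfolding char by (meson mdivides_add_left)
    qed
    with r v show "fvec_scale r v \<in> embed ` ?I" unfolding char by simp
  next
    fix v p assume v: "v \<in> embed ` ?I"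
    have "keys (lookup (hcomp p v) x) \<subseteq> keys (lookup v x)" for x
      by (auto simp: in_keys_iff lookup_hcomp)
    with v show "hcomp p v \<in> embed ` ?I" unfolding char by (meson hcomp_free_module subsetD)
  qed
qed

section \<open>Squarefree monomials and separated intervals\<close>

text \<open>
  The exponent vector of the squarefree monomial with support \<open>X\<close>.
\<close>
definition ind :: "nat set \<Rightarrow> monomial" where
  "ind X = (\<Sum>j\<in>X. single j 1)"

lemma lookup_ind: "finite X \<Longrightarrow> lookup (ind X) j = (if j \<in> X then 1 else 0)"
  by (simp add: ind_def lookup_sum lookup_single when_def)

lemma keys_ind: "finite X \<Longrightarrow> keys (ind X) = X"
  by (auto simp: in_keys_iff lookup_ind split: if_splits)

lemma mdegree_ind: "finite X \<Longrightarrow> mdegree (ind X) = card X"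
  by (simp add: mdegree_def keys_ind lookup_ind)

lemma mdivides_ind: "finite X \<Longrightarrow> mdivides (ind X) u \<longleftrightarrow> X \<subseteq> keys u"
  by (auto simp: mdivides_def lookup_ind in_keys_iff)

lemma prod_var: "finite F \<Longrightarrow> (\<Prod>j\<in>F. var j) = (monom (ind F) :: 'a::field mpoly)"
  by (induction F rule: finite_induct) (simp_all add: ind_def monom_def var_def mult_single)

text \<open>
  Matchings are represented by increasing sequences of left endpoints \<open>a 0, \<dots>, a (k - 1)\<close>
  rather than by sets of intervals, so that a single interval can be moved by a function update.
\<close>
definition separated :: "nat \<Rightarrow> nat \<Rightarrow> (nat \<Rightarrow> nat) \<Rightarrow> bool" where
  "separated t k a \<longleftrightarrow> (\<forall>i j. i < j \<and> j < k \<longrightarrow> a i + t \<le> a j)"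

definition cover :: "nat \<Rightarrow> nat \<Rightarrow> (nat \<Rightarrow> nat) \<Rightarrow> nat set" where
  "cover t k a = (\<Union>i<k. {a i..<a i + t})"

lemma finite_cover [simp]: "finite (cover t k a)" by (simp add: cover_def)

lemma separated_disjoint:
  assumes "separated t k a" "i < k" "j < k" "i \<noteq> j"
  shows "{a i..<a i + t} \<inter> {a j..<a j + t} = {}"
proof -
  have "a i + t \<le> a j \<or> a j + t \<le> a i"
    using assms unfolding separated_def by (metis linorder_neqE_nat)
  then show ?thesis by auto
qed

lemma card_cover: "separated t k a \<Longrightarrow> card (cover t k a) = k * t"
  unfolding cover_def using separated_disjoint[of t k a]
  by (subst card_UN_disjoint) (blast | simp)+

lemma ind_cover: "separated t k a \<Longrightarrow> ind (cover t k a) = (\<Sum>i<k. ind {a i..<a i + t})"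
  unfolding cover_def ind_def using separated_disjoint[of t k a]
  by (subst sum.UNION_disjoint) (blast | simp)+

text \<open>
  A point in two of the intervals would get exponent \<open>2\<close>. So the intervals are pairwise disjoint, and
  sorting their left endpoints gives a separated sequence.
\<close>
lemma squarefree_sum_separated:
  assumes t: "1 \<le> t" and sq: "squarefree_monomial (\<Sum>i<k. ind {a i..<a i + t})"
  obtains a' where "separated t k a'" "a' ` {..<k} = a ` {..<k}"
    "(\<Sum>i<k. ind {a i..<a i + t}) = ind (cover t k a')"
proof -
  have disj: "{a i..<a i + t} \<inter> {a j..<a j + t} = {}" if ij: "i < k" "j < k" "i \<noteq> j" for i j
  proof (rule ccontr)
    assume "{a i..<a i + t} \<inter> {a j..<a j + t} \<noteq> {}"
    then obtain x where x: "x \<in> {a i..<a i + t}" "x \<in> {a j..<a j + t}" by blast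
    let ?g = "\<lambda>i. lookup (ind {a i..<a i + t}) x"
    have "2 = (\<Sum>i\<in>{i, j}. ?g i)" using x ij by (simp add: lookup_ind)
    also have "\<dots> \<le> (\<Sum>i<k. ?g i)" using ij by (intro sum_mono2) auto
    also have "\<dots> \<le> 1" using sq by (simp add: squarefree_monomial_def flip: lookup_sum)
    finally show False by simp
  qed
  have inj: "inj_on a {..<k}"
  proof (rule inj_onI, rule ccontr)
    fix i j assume "i \<in> {..<k}" "j \<in> {..<k}" "a i = a j" "i \<noteq> j"
    with disj[of i j] t show False by simp
  qed
  define xs where "xs = sorted_list_of_set (a ` {..<k})"
  define a' where "a' i = xs ! i" for i
  have xs: "set xs = a ` {..<k}" "sorted_wrt (<) xs" "length xs = k" "distinct xs"
    using inj by (auto simp: xs_def card_image)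
  have bij: "bij_betw a' {..<k} (a ` {..<k})"
    unfolding a'_def using bij_betw_nth[OF xs(4)] xs by simp
  have sep: "separated t k a'"
    unfolding separated_def
  proof (intro allI impI, elim conjE)
    fix i j assume ij: "i < j" "j < k"
    have lt: "a' i < a' j" unfolding a'_def using sorted_wrt_nth_less[OF xs(2) ij(1)] ij xs(3) by simp
    have "a' i \<in> a ` {..<k}" "a' j \<in> a ` {..<k}" using bij_betwE[OF bij] ij by auto
    then obtain i' j' where i': "i' < k" "a' i = a i'" and j': "j' < k" "a' j = a j'" by auto
    then have "{a' i..<a' i + t} \<inter> {a' j..<a' j + t} = {}" using disj[of i' j'] lt by auto
    moreover have "a' j \<in> {a' j..<a' j + t}" using t by simp
    ultimately have "a' j \<notin> {a' i..<a' i + t}" by blast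
    with lt show "a' i + t \<le> a' j" by simp
  qed
  have "(\<Sum>i<k. ind {a i..<a i + t}) = (\<Sum>x\<in>a ` {..<k}. ind {x..<x + t})"
    by (simp add: sum.reindex[OF inj])
  also have "\<dots> = (\<Sum>i<k. ind {a' i..<a' i + t})"
    using sum.reindex_bij_betw[OF bij, of "\<lambda>x. ind {x..<x + t}"] by simp
  also have "\<dots> = ind (cover t k a')" by (simp add: ind_cover[OF sep])
  finally show thesis using that sep bij_betw_imp_surj_on[OF bij] by blast
qed

definition matching_monomials :: "nat \<Rightarrow> nat \<Rightarrow> nat \<Rightarrow> monomial set" where
  "matching_monomials n t k =
     {ind (cover t k a) | a. separated t k a \<and> (\<forall>i<k. a i \<in> {1..n - t + 1})}"

lemma squarefree_power_path_ideal:
  assumes "1 \<le> t" "t \<le> n"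
  shows "squarefree_power n (facet_ideal n (path_complex n t)) k =
    (mono_ideal n (matching_monomials n t k) :: 'a::field mpoly set)"
proof -
  let ?F = "\<lambda>i. ind {i..<i + t}"
  define P where "P = ?F ` {1..n - t + 1}"
  have keys_F: "keys (?F i) \<subseteq> {1..n}" if "i \<in> {1..n - t + 1}" for i
    using that assms by (auto simp: keys_ind)
  then have keys_P: "keys s \<subseteq> {1..n}" if "s \<in> P" for s using that unfolding P_def by blast
  have interval: "{i..i + t - 1} = {i..<i + t}" for i using assms(1) by auto
  have "{(\<Prod>j \<in> F. var j) | F. F \<in> facets (path_complex n t)} = (monom ` P :: 'a mpoly set)"
    unfolding facets_path_complex[OF assms] interval P_def image_image
    by (auto simp: prod_var intro!: exI)
  then have I: "facet_ideal n (path_complex n t) = (mono_ideal n P :: 'a mpoly set)"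
    unfolding facet_ideal_def using ideal_gen_monom[OF keys_P] by simp
  define Q where "Q = {\<Sum>i<k. g i | g. \<forall>i<k. g i \<in> P}"
  have Q: "keys s \<subseteq> {1..n} \<and> mdegree s = k * t" if "s \<in> Q" for s
  proof -
    from that obtain g where g: "s = (\<Sum>i<k. g i)" "\<forall>i<k. g i \<in> P" by (auto simp: Q_def)
    have "keys (\<Sum>i<j. g i) \<subseteq> {1..n} \<and> mdegree (\<Sum>i<j. g i) = j * t" if "j \<le> k" for j
      using that
    proof (induction j)
      case (Suc j)
      then have "g j \<in> P" using g(2) by simp
      then have "keys (g j) \<subseteq> {1..n}" "mdegree (g j) = t"
        using keys_P by (auto simp: P_def mdegree_ind)
      with Suc show ?case by (simp add: keys_add_nat mdegree_add)
    qed simp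
    then show ?thesis using g(1) by simp
  qed
  have gens: "min_monomial_gens (ideal_power n (mono_ideal n P :: 'a mpoly set) k) = Q"
  proof -
    have "ideal_power n (mono_ideal n P :: 'a mpoly set) k = mono_ideal n Q"
      unfolding Q_def by (rule ideal_power_mono_ideal[OF keys_P])
    then show ?thesis using Q by (simp add: min_monomial_gens_mono_ideal[of Q n "k * t"])
  qed
  have "{m \<in> Q. squarefree_monomial m} = matching_monomials n t k"
  proof (intro set_eqI iffI)
    fix m assume "m \<in> {m \<in> Q. squarefree_monomial m}"
    then obtain g where g: "m = (\<Sum>i<k. g i)" "\<forall>i<k. g i \<in> P" and sq: "squarefree_monomial m"
      by (auto simp: Q_def)
    then have "\<forall>i. \<exists>x. i < k \<longrightarrow> x \<in> {1..n - t + 1} \<and> g i = ?F x"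
      unfolding P_def by blast
    then obtain a where a: "\<And>i. i < k \<Longrightarrow> a i \<in> {1..n - t + 1} \<and> g i = ?F (a i)" by metis
    then have m: "m = (\<Sum>i<k. ?F (a i))" by (simp add: g(1))
    obtain a' where a': "separated t k a'" "a' ` {..<k} = a ` {..<k}"
        "(\<Sum>i<k. ?F (a i)) = ind (cover t k a')"
      by (rule squarefree_sum_separated[OF assms(1) sq[unfolded m]])
    have "a' i \<in> {1..n - t + 1}" if "i < k" for i
    proof -
      have "a' i \<in> a ` {..<k}" using a'(2) that by blast
      with a show ?thesis by auto
    qed
    with a' show "m \<in> matching_monomials n t k" unfolding matching_monomials_def m by blast
  next
    fix m assume "m \<in> matching_monomials n t k"
    then obtain a where a: "m = ind (cover t k a)" "separated t k a" "\<forall>i<k. a i \<in> {1..n - t + 1}"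
      unfolding matching_monomials_def by blast
    have "m = (\<Sum>i<k. ?F (a i))" by (simp add: a ind_cover)
    moreover have "\<forall>i<k. ?F (a i) \<in> P" using a(3) by (simp add: P_def)
    ultimately have "m \<in> Q" unfolding Q_def by (intro CollectI exI[of _ "\<lambda>i. ?F (a i)"]) simp
    moreover have "squarefree_monomial m" by (simp add: a squarefree_monomial_def lookup_ind)
    ultimately show "m \<in> {m \<in> Q. squarefree_monomial m}" by simp
  qed
  then show ?thesis
    unfolding squarefree_power_def I gens
    using Q by (subst ideal_gen_monom[symmetric]) auto
qed

section \<open>Sliding one matching onto another\<close>

lemma linked_sym: "linked S u s s' \<Longrightarrow> linked S u s' s"
  unfolding linked_def by blast

lemma linked_ind:
  assumes "ind A \<in> S" "ind B \<in> S" "finite A" "finite B" "A \<union> B \<subseteq> keys u"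
    and "card (A \<union> B) \<noteq> mdegree u"
  shows "linked S u (ind A) (ind B)"
  unfolding linked_def
proof (intro conjI exI)
  show "mdivides (ind A) (ind (A \<union> B))" "mdivides (ind B) (ind (A \<union> B))"
      "mdivides (ind (A \<union> B)) u"
    using assms by (auto simp: mdivides_ind keys_ind)
  show "ind (A \<union> B) \<noteq> u" using assms by (auto simp: mdegree_ind)
qed (use assms in auto)

text \<open>
  Induction on the total distance \<open>\<Sum> (a\<^sub>i - c\<^sub>i)\<close>. The leftmost interval with \<open>a i \<noteq> c i\<close> moves to \<open>x\<close>, which
  is \<open>a i - 1\<close> if it overlaps its target and \<open>c i\<close> otherwise. The first choice
  stays inside the vertex set of \<open>u\<close> because the interval and its target overlap there; a direct
  jump onto an overlapping target could give a union of any size between \<open>kt + 1\<close> and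
  \<open>(k + 1)t\<close>, possibly that of the degree of \<open>u\<close>. The intervals to the left
  are already in place, so the moved interval does not collide with them.
\<close>
lemma slide_down:
  assumes u: "mdegree u \<notin> {k * t + 1, (k + 1) * t}"
    and c: "separated t k c" "cover t k c \<subseteq> keys u" "\<And>i. i < k \<Longrightarrow> c i \<in> {1..n - t + 1}"
    and a: "separated t k a" "cover t k a \<subseteq> keys u" "\<And>i. i < k \<Longrightarrow> a i \<in> {1..n - t + 1}"
    and le: "\<And>i. i < k \<Longrightarrow> c i \<le> a i"
  shows "(linked (matching_monomials n t k) u)\<^sup>*\<^sup>* (ind (cover t k a)) (ind (cover t k c))"
  using a le
proof (induction "\<Sum>i<k. a i - c i" arbitrary: a rule: less_induct)
  case less
  note a = less.prems
  show ?case
  proof (cases "\<forall>i<k. a i = c i")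
    case True
    then have "cover t k a = cover t k c" by (auto simp: cover_def)
    then show ?thesis by simp
  next
    case False
    define i where "i = (LEAST i. i < k \<and> a i \<noteq> c i)"
    from False have i: "i < k" "a i \<noteq> c i"
      unfolding i_def by (metis (mono_tags, lifting) LeastI_ex)+
    have before: "a j = c j" if "j < i" for j
      using that i(1) not_less_Least[of j "\<lambda>i. i < k \<and> a i \<noteq> c i"] by (simp add: i_def)
    have ci: "c i < a i" using a(4)[OF i(1)] i(2) by simp
    define x where "x = (if a i < c i + t then a i - 1 else c i)"
    have x: "c i \<le> x" "x < a i" using ci by (auto simp: x_def)
    define a' where "a' = a(i := x)"
    have a'_simps: "a' i = x" "\<And>j. j \<noteq> i \<Longrightarrow> a' j = a j" by (simp_all add: a'_def)
    have sep: "separated t k a'"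
      unfolding separated_def
    proof (intro allI impI, elim conjE)
      fix j l assume jl: "j < l" "l < k"
      have "a j + t \<le> a l" "c j + t \<le> c l"
        using jl a(1) c(1) unfolding separated_def by blast+
      then show "a' j + t \<le> a' l"
        using before[of j] x jl unfolding a'_def by (auto split: if_splits)
    qed
    have sub: "{x..<x + t} \<subseteq> {c i..<c i + t} \<union> {a i..<a i + t}"
      using ci by (auto simp: x_def)
    have "{c i..<c i + t} \<subseteq> keys u" "{a i..<a i + t} \<subseteq> keys u"
      using c(2) a(2) i(1) by (auto simp: cover_def)
    with sub have sub_u: "{x..<x + t} \<subseteq> keys u" by blast
    have un: "cover t k a \<union> cover t k a' = cover t k a \<union> {x..<x + t}"
    proof -
      have "cover t k a' = (\<Union>j\<in>{..<k} - {i}. {a j..<a j + t}) \<union> {x..<x + t}"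
        unfolding cover_def using i(1) by (auto simp: a'_def split: if_splits)
      then show ?thesis by (auto simp: cover_def)
    qed
    have "cover t k a' \<subseteq> keys u" using un sub_u a(2) by blast
    have int: "{x..<x + t} \<inter> cover t k a = {x..<x + t} \<inter> {a i..<a i + t}"
    proof -
      have "{x..<x + t} \<inter> {a j..<a j + t} = {}" if "j < k" "j \<noteq> i" for j
        using separated_disjoint[OF sep i(1) that(1)] that a'_simps by simp
      then have "{x..<x + t} \<inter> {a j..<a j + t} \<subseteq> {a i..<a i + t}" if "j < k" for j
        using that by (cases "j = i") blast+
      moreover have "{a i..<a i + t} \<subseteq> cover t k a" using i(1) by (auto simp: cover_def)
      ultimately show ?thesis unfolding cover_def by blast
    qed
    have "card (cover t k a \<union> {x..<x + t}) + card ({x..<x + t} \<inter> {a i..<a i + t}) = k * t + t"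
      using card_Un_Int[of "cover t k a" "{x..<x + t}"] int card_cover[OF a(1)]
      by (simp add: Int_commute)
    moreover have "card ({x..<x + t} \<inter> {a i..<a i + t}) = (if a i < c i + t then t - 1 else 0)"
      using ci by (auto simp: x_def)
    moreover have "1 \<le> t" if "a i < c i + t" using that ci by simp
    ultimately have "card (cover t k a \<union> cover t k a') \<in> {k * t + 1, (k + 1) * t}"
      unfolding un by (auto split: if_splits)
    with u have card: "card (cover t k a \<union> cover t k a') \<noteq> mdegree u" by metis
    have range: "a' j \<in> {1..n - t + 1}" if "j < k" for j
      using a(3)[OF that] c(3)[OF i(1)] a(3)[OF i(1)] x by (auto simp: a'_def)
    have "linked (matching_monomials n t k) u (ind (cover t k a)) (ind (cover t k a'))"
      by (rule linked_ind)
        (use a sep range card \<open>cover t k a' \<subseteq> keys u\<close> in \<open>auto simp: matching_monomials_def\<close>)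
    moreover have "(linked (matching_monomials n t k) u)\<^sup>*\<^sup>* (ind (cover t k a')) (ind (cover t k c))"
    proof (rule less.hyps[OF _ sep \<open>cover t k a' \<subseteq> keys u\<close> range])
      show "(\<Sum>j<k. a' j - c j) < (\<Sum>j<k. a j - c j)"
        using i(1) x by (intro sum_strict_mono_ex1) (auto simp: a'_def intro!: bexI[of _ i])
      show "c j \<le> a' j" if "j < k" for j using a(4)[OF that] x(1) by (simp add: a'_def)
    qed
    ultimately show ?thesis by (rule converse_rtranclp_into_rtranclp)
  qed
qed

text \<open>
  Both generators slide down to the sequence of pointwise minima.
\<close>
lemma matching_monomials_connected:
  assumes u: "mdegree u \<notin> {k * t + 1, (k + 1) * t}"
    and s: "s \<in> matching_monomials n t k" "s' \<in> matching_monomials n t k"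
    and div: "mdivides s u" "mdivides s' u"
  shows "(linked (matching_monomials n t k) u)\<^sup>*\<^sup>* s s'"
proof -
  obtain a where a: "s = ind (cover t k a)" "separated t k a" "\<And>i. i < k \<Longrightarrow> a i \<in> {1..n - t + 1}"
    using s(1) unfolding matching_monomials_def by blast
  obtain b where b: "s' = ind (cover t k b)" "separated t k b" "\<And>i. i < k \<Longrightarrow> b i \<in> {1..n - t + 1}"
    using s(2) unfolding matching_monomials_def by blast
  have cov: "cover t k a \<subseteq> keys u" "cover t k b \<subseteq> keys u"
    using div by (simp_all add: a b mdivides_ind)
  define c where "c i = min (a i) (b i)" for i
  have c: "separated t k c" "cover t k c \<subseteq> keys u" "\<And>i. i < k \<Longrightarrow> c i \<in> {1..n - t + 1}"
  proof -
    show "separated t k c"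
      using a(2) b(2) unfolding separated_def c_def by (fastforce simp: min_def)
    have "{c i..<c i + t} \<subseteq> {a i..<a i + t} \<union> {b i..<b i + t}" for i
      by (auto simp: c_def min_def)
    then have "cover t k c \<subseteq> cover t k a \<union> cover t k b"
      unfolding cover_def by blast
    with cov show "cover t k c \<subseteq> keys u" by blast
    show "\<And>i. i < k \<Longrightarrow> c i \<in> {1..n - t + 1}" using a(3) b(3) by (auto simp: c_def min_def)
  qed
  have "(linked (matching_monomials n t k) u)\<^sup>*\<^sup>* s (ind (cover t k c))"
    unfolding a(1) by (rule slide_down[OF u c a(2) cov(1) a(3)]) (auto simp: c_def)
  moreover have "(linked (matching_monomials n t k) u)\<^sup>*\<^sup>* s' (ind (cover t k c))"
    unfolding b(1) by (rule slide_down[OF u c b(2) cov(2) b(3)]) (auto simp: c_def)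
  then have "(linked (matching_monomials n t k) u)\<^sup>*\<^sup>* (ind (cover t k c)) s'"
    using symp_rtranclp[of "linked (matching_monomials n t k) u"] linked_sym
    by (metis sympI sympD)
  ultimately show ?thesis by (rule rtranclp_trans)
qed

theorem theorem3p7:
  fixes n t k p :: nat
    and I :: "'a::field mpoly set"
  assumes "1 \<le> t" and "t \<le> n"
    and "I = facet_ideal n (path_complex n t)"
    and "1 \<le> k" and "k \<le> matching_number (path_complex n t)"
    and "p \<notin> {k * t + 1, (k + 1) * t}"
  shows "graded_betti n (squarefree_power n I k) 1 p = 0"
proof -
  let ?S = "matching_monomials n t k"
  have J: "squarefree_power n I k = mono_ideal n ?S"
    using squarefree_power_path_ideal[OF assms(1,2)] assms(3) by simp
  have keys_S: "keys s \<subseteq> {1..n}" if "s \<in> ?S" for s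
    using that assms(1,2) by (fastforce simp: matching_monomials_def keys_ind cover_def)
  have zero: "b 1 p = 0" if "minimal_graded_free_resolution n (mono_ideal n ?S :: 'a mpoly set) b e d" for b e d
    by (rule monomial_ideal_betti_1_zero[OF keys_S _ that])
      (use assms(6) in \<open>auto intro!: matching_monomials_connected\<close>)
  obtain b e d where "minimal_graded_free_resolution n (mono_ideal n ?S :: 'a mpoly set) b e d"
    using minimal_resolution_exists[OF graded_mono_ideal] by blast
  then have "(\<exists>b e d. minimal_graded_free_resolution n (mono_ideal n ?S :: 'a mpoly set) b e d
      \<and> b 1 p = c) \<longleftrightarrow> c = 0" for c
    using zero by metis
  then show ?thesis unfolding graded_betti_def J by simp
qed

end
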